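(* For each $n$, let $\{\eta_{n,v}: v\in V_n\}$ be a centered (mean zero) Gaussian field indexed by a finite nonempty set $V_n$, and for $S\subseteq V_n$ put $g_n(S)=\mathbb{E}[\sup_{v\in S}\eta_{n,v}]$ and $\sigma_n^2=\sup_{v\in V_n}\mathbb{E}[\eta_{n,v}^2]$. Assume the sequence is non-degenerate, i.e. $$\lim_{n\to\infty}\frac{g_n(V_n)}{\sigma_n}=\infty.$$ Fix $0<\alpha<1$ and define the (random) level set $$U_{n,\alpha}=\{v\in V_n:\ \eta_{n,v}\ge \alpha\, g_n(V_n)\}.$$ Then $$\frac{g_n(U_{n,\alpha})}{g_n(V_n)}\longrightarrow \sqrt{1-\alpha^2}\quad\text{in probability as } n\to\infty.$$
   Context: $g_n$ is a deterministic set function determined by the law of the field; $g_n(U_{n,\alpha})$ denotes the random variable obtained by evaluating $g_n$ at the random set $U_{n,\alpha}$ (i.e. $g_n(U_{n,\alpha})=\mathbb{E}[\sup_{v\in S}\eta_{n,v}]$ evaluated at $S=U_{n,\alpha}$, the expectation being with respect to the law of the field, not conditional on $U_{n,\alpha}$). Convention: $g_n(\emptyset)=-\infty$. *)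

theory Defs
  imports "HOL-Probability.Probability"
begin

definition centered_normal_rv :: "'a measure \<Rightarrow> ('a \<Rightarrow> real) \<Rightarrow> bool" where
  "centered_normal_rv M X \<longleftrightarrow> X \<in> borel_measurable M \<and>
     ((AE \<omega> in M. X \<omega> = 0) \<or> (\<exists>\<sigma>>0. distributed M lborel X (normal_density 0 \<sigma>)))"

text \<open>A centered Gaussian field indexed by V: every finite linear combination is
  centered normal (jointly Gaussian, mean zero).\<close>
definition centered_gaussian_field ::
    "'a measure \<Rightarrow> 'b set \<Rightarrow> ('b \<Rightarrow> 'a \<Rightarrow> real) \<Rightarrow> bool" where
  "centered_gaussian_field M V \<eta> \<longleftrightarrow> prob_space M \<and>
     (\<forall>c :: 'b \<Rightarrow> real. centered_normal_rv M (\<lambda>\<omega>. \<Sum>v\<in>V. c v * \<eta> v \<omega>))"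

definition exp_sup :: "'a measure \<Rightarrow> ('b \<Rightarrow> 'a \<Rightarrow> real) \<Rightarrow> 'b set \<Rightarrow> ereal" where
  "exp_sup M \<eta> S = (if S = {} then -\<infinity>
       else ereal (integral\<^sup>L M (\<lambda>\<omega>. Max ((\<lambda>v. \<eta> v \<omega>) ` S))))"

definition max_sd :: "'a measure \<Rightarrow> ('b \<Rightarrow> 'a \<Rightarrow> real) \<Rightarrow> 'b set \<Rightarrow> real" where
  "max_sd M \<eta> V = sqrt (Max ((\<lambda>v. integral\<^sup>L M (\<lambda>\<omega>. (\<eta> v \<omega>)\<^sup>2)) ` V))"

definition level_set ::
    "('b \<Rightarrow> 'a \<Rightarrow> real) \<Rightarrow> 'b set \<Rightarrow> real \<Rightarrow> real \<Rightarrow> 'a \<Rightarrow> 'b set" where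
  "level_set \<eta> V \<alpha> t \<omega> = {v \<in> V. \<eta> v \<omega> \<ge> \<alpha> * t}"

end

theory Submission
  imports Defs
begin

text \<open>
  Let \<open>\<eta>'\<close> be an independent copy of the field \<open>\<eta>\<close>, \<open>m = g(V)\<close>, and for
  \<open>a\<^sup>2 + b\<^sup>2 = 1\<close> put \<open>\<xi> = a \<eta> + b \<eta>'\<close> and \<open>\<zeta> = b \<eta> - a \<eta>'\<close>. By rotation invariance
  \<open>(\<xi>, \<zeta>)\<close> has the law of \<open>(\<eta>, \<eta>')\<close>, so at the maximizer \<open>v\<close> of \<open>\<xi>\<close> the value
  \<open>\<zeta>(v)\<close> has size at most \<open>\<sigma>\<close>. Rotating \<open>\<eta>\<close> into \<open>\<eta>'\<close> in small steps this gives
  \<open>E |sup \<eta> - m| \<le> \<pi> \<sigma>\<close>.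

  Upper bound: take \<open>a = \<alpha>\<close>, \<open>b = sqrt (1 - \<alpha>\<^sup>2)\<close>. On \<open>U\<close> one has
  \<open>\<xi> \<ge> \<alpha>\<^sup>2 m + b \<eta>'\<close>, and averaging over \<open>\<eta>'\<close> bounds
  \<open>\<alpha>\<^sup>2 m + b g(U) - m\<close> by the conditional mean of \<open>|sup \<xi> - m|\<close>.
  Lower bound: take \<open>a\<close> slightly larger than \<open>\<alpha>\<close>. At the maximizer \<open>v\<close> of \<open>\<xi>\<close> one has
  \<open>\<eta>(v) = a \<xi>(v) + b \<zeta>(v) \<approx> a m\<close>, hence \<open>v \<in> U\<close>, and
  \<open>\<eta>'(v) = b \<xi>(v) - a \<zeta>(v) \<approx> b m\<close>; so \<open>sup\<^sub>U \<eta>'\<close>, which concentrates around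
  \<open>g(U)\<close>, is at least about \<open>b m\<close>.
\<close>

section \<open>Laws determined by their one-dimensional projections\<close>

text \<open>Dividing the weights by their common total mass \<open>w\<close> makes both sides laws
  of real random variables. The phases 0 and -pi/2 give the real and imaginary parts of their
  characteristic functions, so Levy's uniqueness theorem applies. Mass 0 is split off because it
  cannot be normalized.\<close>

lemma weighted_Levy_uniqueness:
  fixes X W :: "'a \<Rightarrow> real" and Y W' :: "'c \<Rightarrow> real"
  assumes "finite_measure M" "finite_measure N"
    and [measurable]: "X \<in> borel_measurable M" "W \<in> borel_measurable M"
      "Y \<in> borel_measurable N" "W' \<in> borel_measurable N"
    and W: "\<And>x. 0 \<le> W x" "\<And>x. W x \<le> C" and W': "\<And>y. 0 \<le> W' y" "\<And>y. W' y \<le> C"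
    and eq: "\<And>s \<psi>. (\<integral>x. W x * cos (s * X x + \<psi>) \<partial>M) = (\<integral>y. W' y * cos (s * Y y + \<psi>) \<partial>N)"
    and [measurable]: "A \<in> sets borel"
  shows "(\<integral>x. W x * indicator A (X x) \<partial>M) = (\<integral>y. W' y * indicator A (Y y) \<partial>N)"
proof -
  define w where "w = (\<integral>x. W x \<partial>M)"
  have intW: "integrable M W"
    using W by (intro finite_measure.integrable_const_bound[OF assms(1), of _ C]) auto
  have intW': "integrable N W'"
    using W' by (intro finite_measure.integrable_const_bound[OF assms(2), of _ C]) auto
  \<comment> \<open>At frequency 0 and phase 0 the cosine is 1, so the two total masses
    agree.\<close>
  have w': "w = (\<integral>y. W' y \<partial>N)"
    using eq[of 0 0] by (simp add: w_def)
  have "0 \<le> w" by (simp add: w_def W)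
  show ?thesis
  proof (cases "w = 0")
    case True
    have "AE x in M. W x = 0"
      using True integral_nonneg_eq_0_iff_AE[OF intW] W by (simp add: w_def)
    then have 1: "(\<integral>x. W x * indicator A (X x) \<partial>M) = 0"
      by (intro integral_eq_zero_AE) auto
    have "AE x in N. W' x = 0"
      using True integral_nonneg_eq_0_iff_AE[OF intW'] W' by (simp add: w')
    then have "(\<integral>x. W' x * indicator A (Y x) \<partial>N) = 0"
      by (intro integral_eq_zero_AE) auto
    with 1 show ?thesis by simp
  next
    case False
    with \<open>0 \<le> w\<close> have w: "0 < w" by simp
    \<comment> \<open>Stated for a generic space \<open>K\<close> because it is applied once to
      \<open>M\<close> and once to \<open>N\<close>.\<close>
    have key: "real_distribution (distr (density K (\<lambda>x. U x / w)) borel Z) \<and>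
        char (distr (density K (\<lambda>x. U x / w)) borel Z) =
          (\<lambda>t. Complex ((\<integral>x. U x * cos (t * Z x + 0) \<partial>K) / w) ((\<integral>x. U x * cos (t * Z x + (-pi/2)) \<partial>K) / w)) \<and>
        (\<integral>x. U x * indicator A (Z x) \<partial>K) = w * measure (distr (density K (\<lambda>x. U x / w)) borel Z) A"
      if K: "finite_measure K" and [measurable]: "U \<in> borel_measurable K" "Z \<in> borel_measurable K"
        and U: "\<And>x. 0 \<le> U x" "\<And>x. U x \<le> C" "integrable K U" "(\<integral>x. U x \<partial>K) = w"
      for K :: "'k measure" and U Z :: "'k \<Rightarrow> real"
    proof -
      let ?D = "density K (\<lambda>x. U x / w)"
      let ?m = "distr ?D borel Z"
      have "emeasure ?D (space ?D) = (\<integral>\<^sup>+x. ennreal (U x / w) \<partial>K)"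
        by (subst emeasure_density) (auto intro!: nn_integral_cong)
      also have "\<dots> = ennreal (\<integral>x. U x / w \<partial>K)"
        using U w by (intro nn_integral_eq_integral) auto
      also have "\<dots> = 1" using U w by simp
      finally have D: "prob_space ?D" by (rule prob_spaceI)
      then interpret D: prob_space ?D .
      have P: "prob_space ?m" by (rule D.prob_space_distr) simp
      then interpret m: prob_space ?m .
      have R: "real_distribution ?m"
        using P by (simp add: real_distribution_def real_distribution_axioms_def)
      have ch: "char ?m t = Complex ((\<integral>x. U x * cos (t * Z x + 0) \<partial>K) / w) ((\<integral>x. U x * cos (t * Z x + (-pi/2)) \<partial>K) / w)" for t
      proof -
        have "char ?m t = (CLINT x|?D. iexp (t * Z x))"
          unfolding char_def by (subst integral_distr) auto
        also have "\<dots> = (CLINT x|K. (U x / w) *\<^sub>R iexp (t * Z x))"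
          using w U by (subst integral_density) auto
        finally have c: "char ?m t = (CLINT x|K. (U x / w) *\<^sub>R iexp (t * Z x))" .
        have i: "integrable K (\<lambda>x. (U x / w) *\<^sub>R iexp (t * Z x))"
          using U w by (intro finite_measure.integrable_const_bound[OF K, of _ "C / w"])
            (auto simp: divide_right_mono)
        have "Re (char ?m t) = (\<integral>x. Re ((U x / w) *\<^sub>R iexp (t * Z x)) \<partial>K)"
          unfolding c using integral_Re[OF i] by simp
        also have "\<dots> = (\<integral>x. (U x * cos (t * Z x + 0)) / w \<partial>K)"
          by (intro Bochner_Integration.integral_cong) (auto simp: Re_exp)
        finally have 1: "Re (char ?m t) = (\<integral>x. U x * cos (t * Z x + 0) \<partial>K) / w" by simp
        have "Im (char ?m t) = (\<integral>x. Im ((U x / w) *\<^sub>R iexp (t * Z x)) \<partial>K)"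
          unfolding c using integral_Im[OF i] by simp
        also have "\<dots> = (\<integral>x. (U x * cos (t * Z x + (-pi/2))) / w \<partial>K)"
          by (intro Bochner_Integration.integral_cong) (auto simp: Im_exp cos_diff)
        finally have 2: "Im (char ?m t) = (\<integral>x. U x * cos (t * Z x + (-pi/2)) \<partial>K) / w" by simp
        from 1 2 show ?thesis by (simp add: complex_eq_iff)
      qed
      have "measure ?m A = (\<integral>z. indicator A z \<partial>?m)" by simp
      also have "\<dots> = (\<integral>x. indicator A (Z x) \<partial>?D)"
        by (subst integral_distr) auto
      also have "\<dots> = (\<integral>x. (U x / w) *\<^sub>R indicator A (Z x) \<partial>K)"
        using w U by (subst integral_density) auto
      also have "\<dots> = (\<integral>x. U x * indicator A (Z x) / w \<partial>K)"
        by (intro Bochner_Integration.integral_cong) auto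
      finally have "measure ?m A = (\<integral>x. U x * indicator A (Z x) \<partial>K) / w" by simp
      then show ?thesis using R ch w by (auto simp: fun_eq_iff)
    qed
    have kM: "real_distribution (distr (density M (\<lambda>x. W x / w)) borel X)"
        "char (distr (density M (\<lambda>x. W x / w)) borel X) =
          (\<lambda>t. Complex ((\<integral>x. W x * cos (t * X x + 0) \<partial>M) / w) ((\<integral>x. W x * cos (t * X x + (-pi/2)) \<partial>M) / w))"
        "(\<integral>x. W x * indicator A (X x) \<partial>M) = w * measure (distr (density M (\<lambda>x. W x / w)) borel X) A"
      using key[OF assms(1), of W X] intW W by (auto simp: w_def)
    have kN: "real_distribution (distr (density N (\<lambda>x. W' x / w)) borel Y)"
        "char (distr (density N (\<lambda>x. W' x / w)) borel Y) =
          (\<lambda>t. Complex ((\<integral>x. W' x * cos (t * Y x + 0) \<partial>N) / w) ((\<integral>x. W' x * cos (t * Y x + (-pi/2)) \<partial>N) / w))"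
        "(\<integral>x. W' x * indicator A (Y x) \<partial>N) = w * measure (distr (density N (\<lambda>x. W' x / w)) borel Y) A"
      using key[OF assms(2), of W' Y] intW' W' by (auto simp: w')
    have "char (distr (density M (\<lambda>x. W x / w)) borel X) = char (distr (density N (\<lambda>x. W' x / w)) borel Y)"
      unfolding kM(2) kN(2) eq ..
    then have "distr (density M (\<lambda>x. W x / w)) borel X = distr (density N (\<lambda>x. W' x / w)) borel Y"
      using kM(1) kN(1) by (intro Levy_uniqueness)
    then show ?thesis
      unfolding kM(3) kN(3) by simp
  qed
qed

text \<open>Cramer-Wold: the phase \<open>\<psi>\<close> encodes real and imaginary part of the characteristic function at
  once. The coordinates are converted from trigonometric to indicator test functions one at a time; the
  weights \<open>1 + cos\<close> keep every intermediate measure nonnegative.\<close>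

lemma distr_PiM_eqI_cos:
  fixes X :: "'i \<Rightarrow> 'a \<Rightarrow> real" and Y :: "'i \<Rightarrow> 'c \<Rightarrow> real"
  assumes "prob_space M" "prob_space N" and I: "finite I"
    and X[measurable]: "\<And>i. i \<in> I \<Longrightarrow> X i \<in> borel_measurable M"
    and Y[measurable]: "\<And>i. i \<in> I \<Longrightarrow> Y i \<in> borel_measurable N"
    and eq: "\<And>t \<psi>. (\<integral>x. cos ((\<Sum>i\<in>I. t i * X i x) + \<psi>) \<partial>M) = (\<integral>y. cos ((\<Sum>i\<in>I. t i * Y i y) + \<psi>) \<partial>N)"
  shows "distr M (PiM I (\<lambda>_. borel)) (\<lambda>x. \<lambda>i\<in>I. X i x) = distr N (PiM I (\<lambda>_. borel)) (\<lambda>y. \<lambda>i\<in>I. Y i y)"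
proof -
  interpret M: prob_space M by fact
  interpret N: prob_space N by fact
  \<comment> \<open>\<open>J\<close> collects the coordinates already tested by indicators. The
    cosine keeps the full sum over \<open>I\<close> with arbitrary \<open>t\<close>, which leaves
    room to shift \<open>t\<close> in the induction step.\<close>
  have step: "(\<integral>x. (\<Prod>j\<in>J. indicator (A j) (X j x)) * cos ((\<Sum>i\<in>I. t i * X i x) + \<psi>) \<partial>M)
      = (\<integral>y. (\<Prod>j\<in>J. indicator (A j) (Y j y)) * cos ((\<Sum>i\<in>I. t i * Y i y) + \<psi>) \<partial>N)"
    if "finite J" "J \<subseteq> I" "\<And>j. j \<in> I \<Longrightarrow> A j \<in> sets borel" for J A t \<psi>
    using that
  proof (induction J arbitrary: t \<psi> rule: finite_induct)
    case empty
    then show ?case using eq by simp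
  next
    case (insert k J)
    have k: "k \<in> I" "J \<subseteq> I" using insert.prems by auto
    have A[measurable]: "\<And>j. j \<in> I \<Longrightarrow> A j \<in> sets borel" by (rule insert.prems)
    have fJ: "finite J" by fact
    define PX where "PX x = (\<Prod>j\<in>J. indicator (A j) (X j x) :: real)" for x
    define PY where "PY y = (\<Prod>j\<in>J. indicator (A j) (Y j y) :: real)" for y
    define SX where "SX t x = (\<Sum>i\<in>I. t i * X i x)" for t x
    define SY where "SY t y = (\<Sum>i\<in>I. t i * Y i y)" for t y
    have IH: "(\<integral>x. PX x * cos (SX t x + \<psi>) \<partial>M) = (\<integral>y. PY y * cos (SY t y + \<psi>) \<partial>N)" for t \<psi>
      using insert.IH[OF k(2) A] by (simp add: PX_def PY_def SX_def SY_def)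
    have Xk[measurable]: "X k \<in> borel_measurable M" "Y k \<in> borel_measurable N" using k X Y by auto
    have [measurable]: "A k \<in> sets borel" using A k by auto
    have PXm[measurable]: "PX \<in> borel_measurable M"
      unfolding PX_def using k by (intro borel_measurable_prod measurable_compose[OF X borel_measurable_indicator[OF A]]) auto
    have PYm[measurable]: "PY \<in> borel_measurable N"
      unfolding PY_def using k by (intro borel_measurable_prod measurable_compose[OF Y borel_measurable_indicator[OF A]]) auto
    have SXm[measurable]: "SX t \<in> borel_measurable M" for t
      unfolding SX_def by (intro borel_measurable_sum borel_measurable_times) auto
    have SYm[measurable]: "SY t \<in> borel_measurable N" for t
      unfolding SY_def by (intro borel_measurable_sum borel_measurable_times) auto
    have PX: "0 \<le> PX x" "PX x \<le> 1" for x
      unfolding PX_def by (auto intro!: prod_nonneg prod_le_1 simp: indicator_def)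
    have PY: "0 \<le> PY x" "PY x \<le> 1" for x
      unfolding PY_def by (auto intro!: prod_nonneg prod_le_1 simp: indicator_def)
    have iX: "integrable M (\<lambda>x. PX x * f x)" if "f \<in> borel_measurable M" "\<And>x. \<bar>f x\<bar> \<le> 1" for f :: "_ \<Rightarrow> real"
      using that PX by (intro M.integrable_const_bound[of _ 1]) (auto simp: abs_mult intro!: mult_le_one)
    have iY: "integrable N (\<lambda>x. PY x * f x)" if "f \<in> borel_measurable N" "\<And>x. \<bar>f x\<bar> \<le> 1" for f :: "_ \<Rightarrow> real"
      using that PY by (intro N.integrable_const_bound[of _ 1]) (auto simp: abs_mult intro!: mult_le_one)
    have w: "(\<integral>x. (PX x * (1 + cos (SX t x + \<psi>))) * indicator (A k) (X k x) \<partial>M)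
       = (\<integral>y. (PY y * (1 + cos (SY t y + \<psi>))) * indicator (A k) (Y k y) \<partial>N)" for t \<psi>
    proof (rule weighted_Levy_uniqueness[where C = 2])
      have b: "0 \<le> 1 + cos z" "1 + cos z \<le> 2" for z :: real
        using cos_ge_minus_one[of z] cos_le_one[of z] by linarith+
      show "0 \<le> PX x * (1 + cos (SX t x + \<psi>))" for x using PX b by simp
      show "0 \<le> PY x * (1 + cos (SY t x + \<psi>))" for x using PY b by simp
      show "PX x * (1 + cos (SX t x + \<psi>)) \<le> 2" for x
        using mult_mono[OF PX(2) b(2) _ b(1)] by simp
      show "PY x * (1 + cos (SY t x + \<psi>)) \<le> 2" for x
        using mult_mono[OF PY(2) b(2) _ b(1)] by simp
      fix s \<phi> :: real
      \<comment> \<open>With \<open>e\<close> the test function in coordinate \<open>k\<close> is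
        itself a cosine of a linear form. The product formula then reduces everything to the
        induction hypothesis at \<open>e\<close>, \<open>t + e\<close> and
        \<open>t - e\<close>.\<close>
      define e where "e = (\<lambda>i. if i = k then s else 0)"
      have e: "SX e x = s * X k x" "SY e y = s * Y k y" for x y
        using k I by (simp_all add: SX_def SY_def e_def if_distrib[of "\<lambda>a. a * _"] cong: if_cong)
      have add: "SX t x + SX u x = SX (\<lambda>i. t i + u i) x" "SY t y + SY u y = SY (\<lambda>i. t i + u i) y"
        "SX t x - SX u x = SX (\<lambda>i. t i - u i) x" "SY t y - SY u y = SY (\<lambda>i. t i - u i) y" for t u x y
        by (simp_all add: SX_def SY_def algebra_simps sum.distrib sum_subtractf)
      have prodsum: "p * (1 + cos (a + \<psi>)) * cos (c + \<phi>) =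
          p * cos (c + \<phi>) + (p * cos ((a + c) + (\<psi> + \<phi>)) + p * cos ((a - c) + (\<psi> - \<phi>))) / 2" for p a c :: real
      proof -
        have "cos ((a + c) + (\<psi> + \<phi>)) = cos ((a + \<psi>) + (c + \<phi>))"
          "cos ((a - c) + (\<psi> - \<phi>)) = cos ((a + \<psi>) - (c + \<phi>))" by (simp_all add: algebra_simps)
        then show ?thesis by (simp only: cos_add[of "a+\<psi>"] cos_diff[of "a+\<psi>"]) (simp add: algebra_simps)
      qed
      have "(\<integral>x. PX x * (1 + cos (SX t x + \<psi>)) * cos (s * X k x + \<phi>) \<partial>M) =
        (\<integral>x. PX x * cos (SX e x + \<phi>) \<partial>M) +
        ((\<integral>x. PX x * cos (SX (\<lambda>i. t i + e i) x + (\<psi> + \<phi>)) \<partial>M) +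
         (\<integral>x. PX x * cos (SX (\<lambda>i. t i - e i) x + (\<psi> - \<phi>)) \<partial>M)) / 2"
        unfolding e[symmetric] prodsum add
        by (simp add: iX)
      also have "\<dots> = (\<integral>x. PY x * cos (SY e x + \<phi>) \<partial>N) +
        ((\<integral>x. PY x * cos (SY (\<lambda>i. t i + e i) x + (\<psi> + \<phi>)) \<partial>N) +
         (\<integral>x. PY x * cos (SY (\<lambda>i. t i - e i) x + (\<psi> - \<phi>)) \<partial>N)) / 2"
        by (simp only: IH)
      also have "\<dots> = (\<integral>x. PY x * (1 + cos (SY t x + \<psi>)) * cos (s * Y k x + \<phi>) \<partial>N)"
        unfolding e[symmetric] prodsum add
        by (simp add: iY)
      finally show "(\<integral>x. PX x * (1 + cos (SX t x + \<psi>)) * cos (s * X k x + \<phi>) \<partial>M) =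
        (\<integral>x. PY x * (1 + cos (SY t x + \<psi>)) * cos (s * Y k x + \<phi>) \<partial>N)" .
    qed (auto intro: M.finite_measure_axioms N.finite_measure_axioms)
    have iX1: "integrable M (\<lambda>x. PX x * (indicator (A k) (X k x) * f x))"
      if "f \<in> borel_measurable M" "\<And>x. \<bar>f x\<bar> \<le> 1" for f :: "_ \<Rightarrow> real"
      using that by (intro iX borel_measurable_times measurable_compose[OF Xk(1) borel_measurable_indicator]) (auto simp: indicator_def)
    have iY1: "integrable N (\<lambda>x. PY x * (indicator (A k) (Y k x) * f x))"
      if "f \<in> borel_measurable N" "\<And>x. \<bar>f x\<bar> \<le> 1" for f :: "_ \<Rightarrow> real"
      using that by (intro iY borel_measurable_times measurable_compose[OF Xk(2) borel_measurable_indicator]) (auto simp: indicator_def)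
    have split: "p * (1 + c) * i = p * (i * 1) + p * (i * c)" for p c i :: real
      by (simp add: algebra_simps)
    have wX: "(\<integral>x. (PX x * (1 + cos (SX t x + \<psi>))) * indicator (A k) (X k x) \<partial>M)
       = (\<integral>x. PX x * (indicator (A k) (X k x) * 1) \<partial>M) + (\<integral>x. PX x * (indicator (A k) (X k x) * cos (SX t x + \<psi>)) \<partial>M)" for t \<psi>
      unfolding split by (intro Bochner_Integration.integral_add iX1) auto
    have wY: "(\<integral>x. (PY x * (1 + cos (SY t x + \<psi>))) * indicator (A k) (Y k x) \<partial>N)
       = (\<integral>x. PY x * (indicator (A k) (Y k x) * 1) \<partial>N) + (\<integral>x. PY x * (indicator (A k) (Y k x) * cos (SY t x + \<psi>)) \<partial>N)" for t \<psi>
      unfolding split by (intro Bochner_Integration.integral_add iY1) auto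
    have z: "SX (\<lambda>_. 0) x = 0" "SY (\<lambda>_. 0) y = 0" for x y by (simp_all add: SX_def SY_def)
    \<comment> \<open>For \<open>t = 0\<close> and phase 0 the weight \<open>1 + cos\<close> is the
      constant 2, so the constant summand agrees by itself and can then be subtracted from
      \<open>w\<close>.\<close>
    have one: "(\<integral>x. PX x * (indicator (A k) (X k x) * 1) \<partial>M) = (\<integral>x. PY x * (indicator (A k) (Y k x) * 1) \<partial>N)"
      using w[of "\<lambda>_. 0" 0, unfolded wX wY] by (simp add: z)
    have "(\<integral>x. PX x * (indicator (A k) (X k x) * cos (SX t x + \<psi>)) \<partial>M) = (\<integral>x. PY x * (indicator (A k) (Y k x) * cos (SY t x + \<psi>)) \<partial>N)"
      using w[of t \<psi>] unfolding wX wY one by simp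
    then show ?case
      using insert.hyps by (simp add: PX_def PY_def SX_def SY_def mult_ac)
  qed
  let ?P = "PiM I (\<lambda>_. borel :: real measure)"
  have mX[measurable]: "(\<lambda>x. \<lambda>i\<in>I. X i x) \<in> measurable M ?P" by (intro measurable_restrict X)
  have mY[measurable]: "(\<lambda>x. \<lambda>i\<in>I. Y i x) \<in> measurable N ?P" by (intro measurable_restrict Y)
  show ?thesis
  proof (rule measure_eqI_PiM_finite[OF I, where A = "\<lambda>_. space ?P"])
    have "prob_space (distr M ?P (\<lambda>x. \<lambda>i\<in>I. X i x))" by (rule M.prob_space_distr) simp
    then interpret D: prob_space "distr M ?P (\<lambda>x. \<lambda>i\<in>I. X i x)" .
    show "emeasure (distr M ?P (\<lambda>x. \<lambda>i\<in>I. X i x)) (space ?P) \<noteq> \<infinity>" by simp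
    show "range (\<lambda>_::nat. space ?P) \<subseteq> prod_algebra I (\<lambda>_. borel)"
      using I by (auto simp: space_PiM intro!: prod_algebraI_finite)
    fix A :: "'i \<Rightarrow> real set" assume A: "\<And>i. i \<in> I \<Longrightarrow> A i \<in> sets borel"
    have box: "Pi\<^sub>E I A \<in> sets ?P" using A I by (intro sets_PiM_I_finite) auto
    have ind: "indicator (Pi\<^sub>E I A) (\<lambda>i\<in>I. f i) = (\<Prod>j\<in>I. indicator (A j) (f j) :: real)" for f
    proof (cases "\<forall>i\<in>I. f i \<in> A i")
      case True then show ?thesis by (auto simp: indicator_def)
    next
      case False
      then have "(\<Prod>j\<in>I. indicator (A j) (f j) :: real) = 0" using I by (auto simp: indicator_def)
      with False show ?thesis by (auto simp: indicator_def PiE_iff)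
    qed
    have 1: "measure (distr M ?P (\<lambda>x. \<lambda>i\<in>I. X i x)) (Pi\<^sub>E I A) = (\<integral>x. (\<Prod>j\<in>I. indicator (A j) (X j x)) \<partial>M)"
    proof -
      have "measure (distr M ?P (\<lambda>x. \<lambda>i\<in>I. X i x)) (Pi\<^sub>E I A) = (\<integral>z. indicator (Pi\<^sub>E I A) z \<partial>distr M ?P (\<lambda>x. \<lambda>i\<in>I. X i x))"
        using box by (simp add: sets.Int_space_eq1 Int_absorb2 sets.sets_into_space)
      also have "\<dots> = (\<integral>x. indicator (Pi\<^sub>E I A) (\<lambda>i\<in>I. X i x) \<partial>M)"
        using box by (subst integral_distr) auto
      finally show ?thesis by (simp add: ind)
    qed
    have 2: "measure (distr N ?P (\<lambda>x. \<lambda>i\<in>I. Y i x)) (Pi\<^sub>E I A) = (\<integral>x. (\<Prod>j\<in>I. indicator (A j) (Y j x)) \<partial>N)"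
    proof -
      have "measure (distr N ?P (\<lambda>x. \<lambda>i\<in>I. Y i x)) (Pi\<^sub>E I A) = (\<integral>z. indicator (Pi\<^sub>E I A) z \<partial>distr N ?P (\<lambda>x. \<lambda>i\<in>I. Y i x))"
        using box by (simp add: sets.Int_space_eq1 Int_absorb2 sets.sets_into_space)
      also have "\<dots> = (\<integral>x. indicator (Pi\<^sub>E I A) (\<lambda>i\<in>I. Y i x) \<partial>N)"
        using box by (subst integral_distr) auto
      finally show ?thesis by (simp add: ind)
    qed
    have "prob_space (distr N ?P (\<lambda>x. \<lambda>i\<in>I. Y i x))" by (rule N.prob_space_distr) simp
    then interpret E: prob_space "distr N ?P (\<lambda>x. \<lambda>i\<in>I. Y i x)" .
    \<comment> \<open>Taking \<open>J = I\<close> and \<open>t = 0\<close> turns the remaining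
      cosine into 1 and leaves the probabilities of boxes, which determine the law.\<close>
    show "emeasure (distr M ?P (\<lambda>x. \<lambda>i\<in>I. X i x)) (Pi\<^sub>E I A) = emeasure (distr N ?P (\<lambda>x. \<lambda>i\<in>I. Y i x)) (Pi\<^sub>E I A)"
      using step[of I A "\<lambda>_. 0" 0, OF I subset_refl A]
      unfolding D.emeasure_eq_measure E.emeasure_eq_measure 1 2 by simp
  qed auto
qed

section \<open>Rotation invariance of Gaussian vectors\<close>

text \<open>The last identity is the Gaussian characteristic function in the phase form used by
  \<open>distr_PiM_eqI_cos\<close>; it shows that the law depends on the second moment alone. The
  degenerate case fits the same formula with second moment 0; otherwise the variable is scaled to a
  standard normal one.\<close>

lemma (in prob_space) centered_normal_rv_moments:
  assumes "centered_normal_rv M X"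
  shows "integrable M X" "integrable M (\<lambda>\<omega>. (X \<omega>)\<^sup>2)"
    and "expectation (\<lambda>\<omega>. cos (X \<omega> + \<psi>)) = exp (- expectation (\<lambda>\<omega>. (X \<omega>)\<^sup>2) / 2) * cos \<psi>"
proof -
  have X[measurable]: "X \<in> borel_measurable M" using assms by (simp add: centered_normal_rv_def)
  have "integrable M X \<and> integrable M (\<lambda>\<omega>. (X \<omega>)\<^sup>2) \<and>
    expectation (\<lambda>\<omega>. cos (X \<omega> + \<psi>)) = exp (- expectation (\<lambda>\<omega>. (X \<omega>)\<^sup>2) / 2) * cos \<psi>"
  proof (cases "AE \<omega> in M. X \<omega> = 0")
    case True
    have "integrable M X \<longleftrightarrow> integrable M (\<lambda>_. 0::real)"
      using True by (intro integrable_cong_AE) auto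
    moreover have "integrable M (\<lambda>\<omega>. (X \<omega>)\<^sup>2) \<longleftrightarrow> integrable M (\<lambda>_. 0::real)"
      using True by (intro integrable_cong_AE) auto
    moreover have "expectation (\<lambda>\<omega>. (X \<omega>)\<^sup>2) = expectation (\<lambda>_. 0)"
      using True by (intro integral_cong_AE) auto
    moreover have "expectation (\<lambda>\<omega>. cos (X \<omega> + \<psi>)) = expectation (\<lambda>_. cos \<psi>)"
      using True by (intro integral_cong_AE) auto
    ultimately show ?thesis by (simp add: prob_space)
  next
    case False
    then obtain \<sigma> where \<sigma>: "\<sigma> > 0" "distributed M lborel X (normal_density 0 \<sigma>)"
      using assms by (auto simp: centered_normal_rv_def)
    define Z where "Z \<omega> = X \<omega> / \<sigma>" for \<omega>
    have XZ: "X = (\<lambda>\<omega>. \<sigma> * Z \<omega>)" using \<sigma> by (simp add: Z_def)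
    have D: "distributed M lborel Z std_normal_density"
      using normal_standard_normal_convert[OF \<sigma>(1), of X 0] \<sigma>(2) unfolding Z_def by simp
    have Zm[measurable]: "Z \<in> borel_measurable M" unfolding Z_def by simp
    have int: "integrable M (\<lambda>\<omega>. Z \<omega> ^ k)" for k
      using distributed_integrable[OF D, of "\<lambda>x. x ^ k"] integrable_std_normal_moment[of k] by simp
    have Z2: "expectation (\<lambda>\<omega>. (Z \<omega>)\<^sup>2) = 1"
      using distributed_integral[OF D, of "\<lambda>x. x ^ 2"] integral_std_normal_moment_even[of 1] by simp
    have "distr M borel Z = distr M lborel Z" by (intro distr_cong) auto
    also have "\<dots> = std_normal_distribution"
      using distributed_distr_eq_density[OF D] by simp
    finally have dZ: "distr M borel Z = std_normal_distribution" .
    have "(CLINT \<omega>|M. iexp (\<sigma> * Z \<omega>)) = char (distr M borel Z) \<sigma>"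
      unfolding char_def by (subst integral_distr) auto
    then have c: "(CLINT \<omega>|M. iexp (X \<omega>)) = complex_of_real (exp (- \<sigma>\<^sup>2 / 2))"
      by (simp add: dZ char_std_normal_distribution XZ)
    have i: "integrable M (\<lambda>\<omega>. iexp (X \<omega>))"
      by (intro integrable_const_bound[of _ 1]) auto
    have "expectation (\<lambda>\<omega>. Re (iexp (X \<omega>))) = exp (- \<sigma>\<^sup>2 / 2)"
      using integral_Re[OF i] unfolding c by simp
    then have 1: "expectation (\<lambda>\<omega>. cos (X \<omega>)) = exp (- \<sigma>\<^sup>2 / 2)" by (simp add: Re_exp)
    have "expectation (\<lambda>\<omega>. Im (iexp (X \<omega>))) = 0"
      using integral_Im[OF i] unfolding c by simp
    then have 2: "expectation (\<lambda>\<omega>. sin (X \<omega>)) = 0" by (simp add: Im_exp)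
    have i2: "integrable M (\<lambda>\<omega>. cos (X \<omega>))" "integrable M (\<lambda>\<omega>. sin (X \<omega>))"
      by (auto intro!: integrable_const_bound[of _ 1])
    have "expectation (\<lambda>\<omega>. cos (X \<omega> + \<psi>)) = exp (- \<sigma>\<^sup>2 / 2) * cos \<psi>"
      unfolding cos_add using i2 1 2 by simp
    moreover have "expectation (\<lambda>\<omega>. (X \<omega>)\<^sup>2) = \<sigma>\<^sup>2"
      unfolding XZ power_mult_distrib using Z2 by simp
    moreover have "integrable M X" using int[of 1] by (simp add: XZ)
    moreover have "integrable M (\<lambda>\<omega>. (X \<omega>)\<^sup>2)" using int[of 2] by (simp add: XZ power_mult_distrib)
    ultimately show ?thesis by simp
  qed
  then show "integrable M X" "integrable M (\<lambda>\<omega>. (X \<omega>)\<^sup>2)"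
    "expectation (\<lambda>\<omega>. cos (X \<omega> + \<psi>)) = exp (- expectation (\<lambda>\<omega>. (X \<omega>)\<^sup>2) / 2) * cos \<psi>" by auto
qed

section \<open>Measurable choice of a maximizer\<close>

definition argmax_on :: "'b set \<Rightarrow> ('b \<Rightarrow> real) \<Rightarrow> 'b" where
  "argmax_on V f = (SOME v. v \<in> V \<and> f v = Max (f ` V))"

lemma argmax_on:
  assumes "finite V" "V \<noteq> {}"
  shows "argmax_on V f \<in> V" "f (argmax_on V f) = Max (f ` V)"
proof -
  have "Max (f ` V) \<in> f ` V" using assms by (intro Max_in) auto
  then have "\<exists>v. v \<in> V \<and> f v = Max (f ` V)" by auto
  from someI_ex[OF this] show "argmax_on V f \<in> V" "f (argmax_on V f) = Max (f ` V)"
    by (auto simp: argmax_on_def)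
qed

lemma argmax_on_cong:
  assumes "\<And>v. v \<in> V \<Longrightarrow> f v = g v"
  shows "argmax_on V f = argmax_on V g"
proof -
  have "f ` V = g ` V" using assms by (intro image_cong) auto
  then have "(\<lambda>v. v \<in> V \<and> f v = Max (f ` V)) = (\<lambda>v. v \<in> V \<and> g v = Max (g ` V))"
    using assms by auto
  then show ?thesis by (simp add: argmax_on_def)
qed

text \<open>The choice depends only on the random set \<open>A x\<close> of maximizers, which ranges
  over the finite set \<open>Pow V\<close>. Hence it is enough that each event
  \<open>A x = S\<close> is measurable; the choice function on \<open>Pow V\<close> needs no
  regularity.\<close>

lemma measurable_argmax_on:
  assumes V: "finite V" "V \<noteq> {}" and f: "\<And>v. v \<in> V \<Longrightarrow> f v \<in> borel_measurable N"
  shows "(\<lambda>x. argmax_on V (\<lambda>v. f v x)) \<in> measurable N (count_space V)"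
proof -
  define A where "A x = {v\<in>V. f v x = Max ((\<lambda>v. f v x) ` V)}" for x
  have "A -` {S} \<inter> space N \<in> sets N" if "S \<in> Pow V" for S
  proof -
    have "A x = S \<longleftrightarrow> (\<forall>v\<in>V. (f v x = Max ((\<lambda>v. f v x) ` V)) = (v \<in> S))" for x
      using that unfolding A_def by blast
    then have "A -` {S} \<inter> space N = {x\<in>space N. \<forall>v\<in>V. (f v x = Max ((\<lambda>v. f v x) ` V)) = (v \<in> S)}"
      by blast
    also have "\<dots> \<in> sets N"
    proof (rule sets.sets_Collect_finite_All'[OF _ V])
      fix v assume "v \<in> V"
      with f have [measurable]: "f v \<in> borel_measurable N" by simp
      have [measurable]: "(\<lambda>x. Max ((\<lambda>v. f v x) ` V)) \<in> borel_measurable N"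
        using V f by (intro borel_measurable_Max)
      show "{x\<in>space N. (f v x = Max ((\<lambda>v. f v x) ` V)) = (v \<in> S)} \<in> sets N"
        by measurable
    qed
    finally show ?thesis .
  qed
  then have A: "A \<in> measurable N (count_space (Pow V))"
    using V by (subst measurable_count_space_eq2) (auto simp: A_def)
  have e: "argmax_on V (\<lambda>v. f v x) = (if A x = {} then SOME v. v \<in> V else SOME v. v \<in> A x)" for x
  proof -
    have "A x \<noteq> {}" using argmax_on[OF V, of "\<lambda>v. f v x"] by (auto simp: A_def)
    then show ?thesis unfolding if_not_P[OF \<open>A x \<noteq> {}\<close>] by (simp add: A_def argmax_on_def)
  qed
  have mem: "(if S = {} then SOME v. v \<in> V else SOME v. v \<in> S) \<in> V" if "S \<in> Pow V" for S
    using that V by (cases "S = {}") (auto simp: some_in_eq intro: subsetD[OF _ someI_ex])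
  have "(\<lambda>S. if S = {} then SOME v. v \<in> V else SOME v. v \<in> S) \<in> measurable (count_space (Pow V)) (count_space V)"
    using mem by (simp add: Pi_iff)
  from measurable_compose[OF A this] show ?thesis unfolding e .
qed

lemma abs_Max_le_sum:
  fixes f :: "'b \<Rightarrow> real"
  assumes "finite V" "V \<noteq> {}"
  shows "\<bar>Max (f ` V)\<bar> \<le> (\<Sum>v\<in>V. \<bar>f v\<bar>)"
proof -
  have "Max (f ` V) \<in> f ` V" using assms by (intro Max_in) auto
  then obtain v where "v \<in> V" "Max (f ` V) = f v" by auto
  then show ?thesis using assms(1) member_le_sum[of v V "\<lambda>v. \<bar>f v\<bar>"] by auto
qed

text \<open>Here \<sigma> is an upper bound for the standard deviations rather than their exact
  maximum, so that every nonempty subfield is an instance with the same \<sigma>.\<close>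

locale gaussian_vector =
  fixes M :: "'a measure" and V :: "'b set" and \<eta> :: "'b \<Rightarrow> 'a \<Rightarrow> real" and \<sigma> :: real
  assumes fin: "finite V" and ne: "V \<noteq> {}"
    and gauss: "centered_gaussian_field M V \<eta>"
    and sd: "\<And>v. v \<in> V \<Longrightarrow> (\<integral>\<omega>. (\<eta> v \<omega>)\<^sup>2 \<partial>M) \<le> \<sigma>\<^sup>2" and \<sigma>_nonneg: "0 \<le> \<sigma>"

sublocale gaussian_vector \<subseteq> prob_space M
  using gauss by (simp add: centered_gaussian_field_def)

text \<open>On the product space, \<open>\<eta> v (fst p)\<close> is the field and
  \<open>\<eta> v (snd p)\<close> its independent copy.\<close>

sublocale gaussian_vector \<subseteq> P: pair_prob_space M M ..

context gaussian_vector
begin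

abbreviation "PP \<equiv> M \<Otimes>\<^sub>M M"

lemma centered_normal_lincomb: "centered_normal_rv M (\<lambda>\<omega>. \<Sum>v\<in>V. c v * \<eta> v \<omega>)"
  using gauss by (simp add: centered_gaussian_field_def)

lemma centered_normal_coord: "v \<in> V \<Longrightarrow> centered_normal_rv M (\<eta> v)"
proof -
  assume v: "v \<in> V"
  have "(\<lambda>\<omega>. \<Sum>u\<in>V. (if u = v then 1 else 0) * \<eta> u \<omega>) = \<eta> v"
    using v fin by (auto simp: if_distrib[of "\<lambda>a. a * _"] cong: if_cong)
  then show ?thesis using centered_normal_lincomb[of "\<lambda>u. if u = v then 1 else 0"] by simp
qed

lemma coord_measurable[measurable]: "v \<in> V \<Longrightarrow> \<eta> v \<in> borel_measurable M"
  using centered_normal_coord by (simp add: centered_normal_rv_def)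

lemma integrable_coord: "v \<in> V \<Longrightarrow> integrable M (\<eta> v)"
  using centered_normal_coord centered_normal_rv_moments by blast

text \<open>The variance of the absolute value is nonnegative, so its squared mean is at most the
  second moment.\<close>

lemma expectation_abs_coord:
  assumes "v \<in> V" shows "expectation (\<lambda>\<omega>. \<bar>\<eta> v \<omega>\<bar>) \<le> \<sigma>"
proof -
  have i: "integrable M (\<lambda>\<omega>. \<bar>\<eta> v \<omega>\<bar>)" "integrable M (\<lambda>\<omega>. \<bar>\<eta> v \<omega>\<bar>\<^sup>2)"
    using assms centered_normal_coord centered_normal_rv_moments(2) integrable_coord by auto
  have "0 \<le> variance (\<lambda>\<omega>. \<bar>\<eta> v \<omega>\<bar>)" by (rule variance_positive)
  then have "(expectation (\<lambda>\<omega>. \<bar>\<eta> v \<omega>\<bar>))\<^sup>2 \<le> expectation (\<lambda>\<omega>. (\<eta> v \<omega>)\<^sup>2)"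
    using variance_eq[OF i] by simp
  also have "\<dots> \<le> \<sigma>\<^sup>2" by (rule sd[OF assms])
  finally show ?thesis using \<sigma>_nonneg by (rule power2_le_imp_le)
qed

lemma integrable_PP_proj:
  fixes f :: "'a \<Rightarrow> real"
  assumes f: "integrable M f"
  shows "integrable PP (\<lambda>p. f (fst p))" "integrable PP (\<lambda>p. f (snd p))"
    "(\<integral>p. f (fst p) \<partial>PP) = (\<integral>\<omega>. f \<omega> \<partial>M)"
proof -
  have [measurable]: "f \<in> borel_measurable M" using f by auto
  show 1: "integrable PP (\<lambda>p. f (fst p))"
    using f by (intro P.Fubini_integrable) (auto simp: prob_space)
  show "integrable PP (\<lambda>p. f (snd p))"
    using f by (intro P.Fubini_integrable) (auto simp: prob_space)
  show "(\<integral>p. f (fst p) \<partial>PP) = (\<integral>\<omega>. f \<omega> \<partial>M)"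
    using P.integral_fst'[OF 1] by (simp add: prob_space)
qed

text \<open>The Boolean tag of an index separates the two fields. A linear form with coefficients
  \<open>(c, d)\<close> has a characteristic function depending only on the sum of the second
  moments of \<open>S c\<close> and \<open>S d\<close>. Rotating the fields replaces
  \<open>(c, d)\<close> by \<open>(c', d')\<close>, and orthogonality preserves that sum.\<close>

lemma rotation_law:
  assumes ab: "a\<^sup>2 + b\<^sup>2 = (1::real)"
  shows "distr PP (PiM (V \<times> UNIV) (\<lambda>_. borel))
      (\<lambda>p. \<lambda>i\<in>V \<times> UNIV. if snd i then \<eta> (fst i) (fst p) else \<eta> (fst i) (snd p)) =
    distr PP (PiM (V \<times> UNIV) (\<lambda>_. borel))
      (\<lambda>p. \<lambda>i\<in>V \<times> UNIV. if snd i then a * \<eta> (fst i) (fst p) + b * \<eta> (fst i) (snd p)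
         else b * \<eta> (fst i) (fst p) - a * \<eta> (fst i) (snd p))"
proof (rule distr_PiM_eqI_cos)
  define S where "S c \<omega> = (\<Sum>v\<in>V. c v * \<eta> v \<omega>)" for c \<omega>
  have Sm[measurable]: "S c \<in> borel_measurable M" for c
    unfolding S_def by (intro borel_measurable_sum borel_measurable_times) auto
  have S2: "integrable M (\<lambda>\<omega>. (S c \<omega>)\<^sup>2)" for c
    unfolding S_def by (rule centered_normal_rv_moments(2)[OF centered_normal_lincomb])
  have Scos: "expectation (\<lambda>\<omega>. cos (S c \<omega> + \<psi>)) = exp (- expectation (\<lambda>\<omega>. (S c \<omega>)\<^sup>2) / 2) * cos \<psi>" for c \<psi>
    unfolding S_def by (rule centered_normal_rv_moments(3)[OF centered_normal_lincomb])
  have two: "(\<integral>p. cos (S c (fst p) + S d (snd p) + \<psi>) \<partial>PP) =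
      exp (- (expectation (\<lambda>\<omega>. (S c \<omega>)\<^sup>2) + expectation (\<lambda>\<omega>. (S d \<omega>)\<^sup>2)) / 2) * cos \<psi>" for c d \<psi>
  proof -
    have i: "integrable PP (\<lambda>p. cos (S c (fst p) + S d (snd p) + \<psi>))"
      by (intro P.P.integrable_const_bound[of _ 1]) auto
    have "(\<integral>p. cos (S c (fst p) + S d (snd p) + \<psi>) \<partial>PP) = (\<integral>x. (\<integral>y. cos (S d y + (S c x + \<psi>)) \<partial>M) \<partial>M)"
      using P.integral_fst'[OF i] by (simp add: ac_simps)
    also have "\<dots> = exp (- expectation (\<lambda>\<omega>. (S d \<omega>)\<^sup>2) / 2) * (\<integral>x. cos (S c x + \<psi>) \<partial>M)"
      unfolding Scos[of d] by simp
    also have "\<dots> = exp (- (expectation (\<lambda>\<omega>. (S c \<omega>)\<^sup>2) + expectation (\<lambda>\<omega>. (S d \<omega>)\<^sup>2)) / 2) * cos \<psi>"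
      unfolding Scos by (simp add: exp_add[symmetric] add_divide_distrib)
    finally show ?thesis .
  qed
  fix t :: "'b \<times> bool \<Rightarrow> real" and \<psi> :: real
  define c where "c v = t (v, True)" for v
  define d where "d v = t (v, False)" for v
  define c' where "c' v = a * c v + b * d v" for v
  define d' where "d' v = b * c v - a * d v" for v
  have sum2: "(\<Sum>i\<in>V \<times> UNIV. f i) = (\<Sum>v\<in>V. f (v, True) + f (v, False))" for f :: "'b \<times> bool \<Rightarrow> real"
    by (subst sum.cartesian_product') (auto simp: UNIV_bool add.commute)
  have 1: "(\<Sum>i\<in>V \<times> UNIV. t i * (if snd i then \<eta> (fst i) (fst p) else \<eta> (fst i) (snd p))) = S c (fst p) + S d (snd p)" for p
    by (simp add: sum2 S_def c_def d_def sum.distrib)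
  have 2: "(\<Sum>i\<in>V \<times> UNIV. t i * (if snd i then a * \<eta> (fst i) (fst p) + b * \<eta> (fst i) (snd p)
         else b * \<eta> (fst i) (fst p) - a * \<eta> (fst i) (snd p))) = S c' (fst p) + S d' (snd p)" for p
    by (simp add: sum2 S_def c'_def d'_def c_def d_def flip: sum.distrib) (simp add: algebra_simps)
  \<comment> \<open>All four forms are taken at the same \<omega>, so the sums of squares agree
    pointwise and the cross terms cancel before any expectation is taken.\<close>
  have "(S c' \<omega>)\<^sup>2 + (S d' \<omega>)\<^sup>2 = (S c \<omega>)\<^sup>2 + (S d \<omega>)\<^sup>2" for \<omega>
  proof -
    have SC: "S c' \<omega> = a * S c \<omega> + b * S d \<omega>" "S d' \<omega> = b * S c \<omega> - a * S d \<omega>"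
      by (simp_all add: S_def c'_def d'_def sum_distrib_left sum.distrib sum_subtractf algebra_simps)
    have "(S c' \<omega>)\<^sup>2 + (S d' \<omega>)\<^sup>2 = (a\<^sup>2 + b\<^sup>2) * ((S c \<omega>)\<^sup>2 + (S d \<omega>)\<^sup>2)"
      unfolding SC by (simp add: power2_eq_square algebra_simps)
    then show ?thesis using ab by simp
  qed
  then have q: "expectation (\<lambda>\<omega>. (S c' \<omega>)\<^sup>2) + expectation (\<lambda>\<omega>. (S d' \<omega>)\<^sup>2)
      = expectation (\<lambda>\<omega>. (S c \<omega>)\<^sup>2) + expectation (\<lambda>\<omega>. (S d \<omega>)\<^sup>2)"
    using S2 by (simp flip: Bochner_Integration.integral_add)
  show "(\<integral>p. cos ((\<Sum>i\<in>V \<times> UNIV. t i * (if snd i then \<eta> (fst i) (fst p) else \<eta> (fst i) (snd p))) + \<psi>) \<partial>PP) =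
     (\<integral>p. cos ((\<Sum>i\<in>V \<times> UNIV. t i * (if snd i then a * \<eta> (fst i) (fst p) + b * \<eta> (fst i) (snd p)
         else b * \<eta> (fst i) (fst p) - a * \<eta> (fst i) (snd p))) + \<psi>) \<partial>PP)"
    unfolding 1 2 two q ..
next
  fix i :: "'b \<times> bool" assume "i \<in> V \<times> UNIV"
  then have [measurable]: "\<eta> (fst i) \<in> borel_measurable M" by auto
  show "(\<lambda>p. if snd i then \<eta> (fst i) (fst p) else \<eta> (fst i) (snd p)) \<in> borel_measurable PP"
    by measurable
  show "(\<lambda>p. if snd i then a * \<eta> (fst i) (fst p) + b * \<eta> (fst i) (snd p)
         else b * \<eta> (fst i) (fst p) - a * \<eta> (fst i) (snd p)) \<in> borel_measurable PP"
    by measurable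
qed (auto intro: P.P.prob_space_axioms fin)

text \<open>Brings functionals of the rotated pair, in particular those evaluated at a random
  maximizer, back to two independent copies.\<close>

lemma rotation_integral:
  fixes F :: "('b \<times> bool \<Rightarrow> real) \<Rightarrow> real"
  assumes ab: "a\<^sup>2 + b\<^sup>2 = (1::real)"
    and F: "F \<in> borel_measurable (PiM (V \<times> UNIV) (\<lambda>_. borel))"
  shows "(\<integral>p. F (\<lambda>i\<in>V \<times> UNIV. if snd i then a * \<eta> (fst i) (fst p) + b * \<eta> (fst i) (snd p)
         else b * \<eta> (fst i) (fst p) - a * \<eta> (fst i) (snd p)) \<partial>PP)
    = (\<integral>p. F (\<lambda>i\<in>V \<times> UNIV. if snd i then \<eta> (fst i) (fst p) else \<eta> (fst i) (snd p)) \<partial>PP)"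
proof -
  have m1: "(\<lambda>p. if snd i then \<eta> (fst i) (fst p) else \<eta> (fst i) (snd p)) \<in> borel_measurable PP"
    if "i \<in> V \<times> UNIV" for i :: "'b \<times> bool"
  proof -
    have [measurable]: "\<eta> (fst i) \<in> borel_measurable M" using that by auto
    show ?thesis by measurable
  qed
  have m2: "(\<lambda>p. if snd i then a * \<eta> (fst i) (fst p) + b * \<eta> (fst i) (snd p)
         else b * \<eta> (fst i) (fst p) - a * \<eta> (fst i) (snd p)) \<in> borel_measurable PP"
    if "i \<in> V \<times> UNIV" for i :: "'b \<times> bool"
  proof -
    have [measurable]: "\<eta> (fst i) \<in> borel_measurable M" using that by auto
    show ?thesis by measurable
  qed
  have "(\<integral>p. F (\<lambda>i\<in>V \<times> UNIV. if snd i then \<eta> (fst i) (fst p) else \<eta> (fst i) (snd p)) \<partial>PP) =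
     integral\<^sup>L (distr PP (PiM (V \<times> UNIV) (\<lambda>_. borel))
      (\<lambda>p. \<lambda>i\<in>V \<times> UNIV. if snd i then \<eta> (fst i) (fst p) else \<eta> (fst i) (snd p))) F"
    by (rule integral_distr[symmetric]) (intro measurable_restrict m1 F, assumption, rule F)
  also have "\<dots> = (\<integral>p. F (\<lambda>i\<in>V \<times> UNIV. if snd i then a * \<eta> (fst i) (fst p) + b * \<eta> (fst i) (snd p)
         else b * \<eta> (fst i) (fst p) - a * \<eta> (fst i) (snd p)) \<partial>PP)"
    unfolding rotation_law[OF ab]
    by (rule integral_distr) (intro measurable_restrict m2 F, assumption, rule F)
  finally show ?thesis ..
qed

end

section \<open>Concentration of the supremum\<close>

context gaussian_vector
begin

text \<open>With \<open>a\<^sup>2 + b\<^sup>2 = 1\<close>, the fields \<open>rot a b\<close> and \<open>rot b (-a)\<close> are the rotation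
  of two independent copies of \<open>\<eta>\<close>.\<close>

definition rot :: "real \<Rightarrow> real \<Rightarrow> 'a \<times> 'a \<Rightarrow> 'b \<Rightarrow> real" where
  "rot a b p v = a * \<eta> v (fst p) + b * \<eta> v (snd p)"

definition mean :: real where
  "mean = expectation (\<lambda>\<omega>. Max ((\<lambda>v. \<eta> v \<omega>) ` V))"

text \<open>For a = cos \<theta> and b = sin \<theta> this is, up to sign, the derivative in
  \<theta> of the rotated field, read off at its current maximizer.\<close>

definition orth_at_argmax :: "real \<Rightarrow> real \<Rightarrow> 'a \<times> 'a \<Rightarrow> real" where
  "orth_at_argmax a b p = rot b (- a) p (argmax_on V (rot a b p))"

lemma rot_measurable[measurable]: "v \<in> V \<Longrightarrow> (\<lambda>p. rot a b p v) \<in> borel_measurable PP"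
  unfolding rot_def by measurable

lemma Max_measurable[measurable]: "(\<lambda>\<omega>. Max ((\<lambda>v. \<eta> v \<omega>) ` V)) \<in> borel_measurable M"
  using fin by (intro borel_measurable_Max) auto

lemma Max_rot_measurable[measurable]: "(\<lambda>p. Max (rot a b p ` V)) \<in> borel_measurable PP"
  using borel_measurable_Max[OF fin, of "\<lambda>v p. rot a b p v" PP] by simp

lemma orth_at_argmax_measurable[measurable]: "orth_at_argmax a b \<in> borel_measurable PP"
proof -
  have "(\<lambda>p. rot b (- a) p (argmax_on V (rot a b p))) \<in> borel_measurable PP"
    by (rule measurable_compose_countable'[where f = "\<lambda>v p. rot b (- a) p v" and I = V])
      (use fin ne measurable_argmax_on[OF fin ne, of "\<lambda>v p. rot a b p v" PP] in \<open>auto intro: countable_finite\<close>)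
  then show ?thesis by (simp add: orth_at_argmax_def[abs_def])
qed

lemma integrable_rot: "v \<in> V \<Longrightarrow> integrable PP (\<lambda>p. rot a b p v)"
  unfolding rot_def
  by (intro Bochner_Integration.integrable_add integrable_mult_right integrable_PP_proj integrable_coord)

lemma integrable_Max: "integrable M (\<lambda>\<omega>. Max ((\<lambda>v. \<eta> v \<omega>) ` V))"
proof (rule Bochner_Integration.integrable_bound)
  show "integrable M (\<lambda>\<omega>. \<Sum>v\<in>V. \<bar>\<eta> v \<omega>\<bar>)"
    by (intro Bochner_Integration.integrable_sum integrable_abs integrable_coord)
  show "AE \<omega> in M. norm (Max ((\<lambda>v. \<eta> v \<omega>) ` V)) \<le> norm (\<Sum>v\<in>V. \<bar>\<eta> v \<omega>\<bar>)"
    using abs_Max_le_sum[OF fin ne] by (intro AE_I2) (simp add: abs_of_nonneg sum_nonneg)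
qed measurable

lemma integrable_Max_rot: "integrable PP (\<lambda>p. Max (rot a b p ` V))"
proof (rule Bochner_Integration.integrable_bound)
  show "integrable PP (\<lambda>p. \<Sum>v\<in>V. \<bar>rot a b p v\<bar>)"
    by (intro Bochner_Integration.integrable_sum integrable_abs integrable_rot)
  show "AE p in PP. norm (Max (rot a b p ` V)) \<le> norm (\<Sum>v\<in>V. \<bar>rot a b p v\<bar>)"
    using abs_Max_le_sum[OF fin ne] by (intro AE_I2) (simp add: abs_of_nonneg sum_nonneg)
qed measurable

text \<open>Fubini gives integrable sections only for almost every \<omega>, whereas the level set
  bounds fix one \<omega>. With \<omega> fixed, the first field contributes only constants, so a
  direct domination works.\<close>

lemma integrable_section_Max_rot: "integrable M (\<lambda>\<omega>'. Max (rot a b (\<omega>, \<omega>') ` V))"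
proof (rule Bochner_Integration.integrable_bound)
  show "integrable M (\<lambda>\<omega>'. \<Sum>v\<in>V. \<bar>rot a b (\<omega>, \<omega>') v\<bar>)"
    unfolding rot_def
    by (intro Bochner_Integration.integrable_sum integrable_abs Bochner_Integration.integrable_add
      integrable_mult_right) (auto intro: integrable_coord)
  show "AE \<omega>' in M. norm (Max (rot a b (\<omega>, \<omega>') ` V)) \<le> norm (\<Sum>v\<in>V. \<bar>rot a b (\<omega>, \<omega>') v\<bar>)"
    using abs_Max_le_sum[OF fin ne] by (intro AE_I2) (simp add: abs_of_nonneg sum_nonneg)
  have "(\<lambda>\<omega>'. rot a b (\<omega>, \<omega>') v) \<in> borel_measurable M" if "v \<in> V" for v
    using that unfolding rot_def by simp
  then show "(\<lambda>\<omega>'. Max (rot a b (\<omega>, \<omega>') ` V)) \<in> borel_measurable M"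
    using borel_measurable_Max[OF fin, of "\<lambda>v \<omega>'. rot a b (\<omega>, \<omega>') v" M] by simp
qed

lemma abs_orth_at_argmax_le: "\<bar>orth_at_argmax a b p\<bar> \<le> (\<Sum>v\<in>V. \<bar>rot b (- a) p v\<bar>)"
  unfolding orth_at_argmax_def
  using argmax_on[OF fin ne] fin by (intro member_le_sum[where f = "\<lambda>v. \<bar>rot b (- a) p v\<bar>"]) auto

lemma integrable_orth_at_argmax: "integrable PP (orth_at_argmax a b)"
proof (rule Bochner_Integration.integrable_bound)
  show "integrable PP (\<lambda>p. \<Sum>v\<in>V. \<bar>rot b (- a) p v\<bar>)"
    by (intro Bochner_Integration.integrable_sum integrable_abs integrable_rot)
  show "AE p in PP. norm (orth_at_argmax a b p) \<le> norm (\<Sum>v\<in>V. \<bar>rot b (- a) p v\<bar>)"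
    using abs_orth_at_argmax_le by (intro AE_I2) (simp add: abs_of_nonneg sum_nonneg)
qed measurable

lemma integrable_section_orth_at_argmax:
  assumes [measurable]: "\<omega> \<in> space M"
  shows "integrable M (\<lambda>\<omega>'. orth_at_argmax a b (\<omega>, \<omega>'))"
proof (rule Bochner_Integration.integrable_bound)
  show "integrable M (\<lambda>\<omega>'. \<Sum>v\<in>V. \<bar>rot b (- a) (\<omega>, \<omega>') v\<bar>)"
    unfolding rot_def
    by (intro Bochner_Integration.integrable_sum integrable_abs Bochner_Integration.integrable_add
      integrable_mult_right) (auto intro: integrable_coord)
  show "AE \<omega>' in M. norm (orth_at_argmax a b (\<omega>, \<omega>')) \<le> norm (\<Sum>v\<in>V. \<bar>rot b (- a) (\<omega>, \<omega>') v\<bar>)"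
    using abs_orth_at_argmax_le by (intro AE_I2) (simp add: abs_of_nonneg sum_nonneg)
qed measurable

lemma integral_abs_Max_rot:
  assumes "a\<^sup>2 + b\<^sup>2 = 1"
  shows "(\<integral>p. \<bar>Max (rot a b p ` V) - c\<bar> \<partial>PP) = expectation (\<lambda>\<omega>. \<bar>Max ((\<lambda>v. \<eta> v \<omega>) ` V) - c\<bar>)"
proof -
  define F where "F x = \<bar>Max ((\<lambda>v. x (v, True)) ` V) - c\<bar>" for x :: "'b \<times> bool \<Rightarrow> real"
  have "(\<lambda>x. Max ((\<lambda>v. x (v, True)) ` V)) \<in> borel_measurable (PiM (V \<times> (UNIV :: bool set)) (\<lambda>_. borel :: real measure))"
    by (rule borel_measurable_Max[OF fin, where f = "\<lambda>v x. x (v, True)"])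
      (auto intro!: measurable_component_singleton)
  then have F: "F \<in> borel_measurable (PiM (V \<times> UNIV) (\<lambda>_. borel))"
    unfolding F_def by measurable
  have "integrable M (\<lambda>\<omega>. \<bar>Max ((\<lambda>v. \<eta> v \<omega>) ` V) - c\<bar>)" using integrable_Max by simp
  from integrable_PP_proj(3)[OF this] rotation_integral[OF assms F]
  show ?thesis by (simp add: F_def rot_def cong: image_cong_simp)
qed

text \<open>The maximizer of \<open>rot a b\<close> is independent of \<open>rot b (-a)\<close>.\<close>

lemma integral_abs_orth_at_argmax:
  assumes "a\<^sup>2 + b\<^sup>2 = 1"
  shows "(\<integral>p. \<bar>orth_at_argmax a b p\<bar> \<partial>PP) \<le> \<sigma>"
proof -
  define F where "F x = \<bar>x (argmax_on V (\<lambda>v. x (v, True)), False)\<bar>" for x :: "'b \<times> bool \<Rightarrow> real"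
  have c: "(\<lambda>x. x (v, j)) \<in> borel_measurable (PiM (V \<times> UNIV) (\<lambda>_. borel :: real measure))" if "v \<in> V" for v and j :: bool
    using that by (auto intro!: measurable_component_singleton)
  have "(\<lambda>x. x (argmax_on V (\<lambda>v. x (v, True)), False)) \<in> borel_measurable (PiM (V \<times> UNIV) (\<lambda>_. borel :: real measure))"
    by (rule measurable_compose_countable'[where f = "\<lambda>v x. x (v, False)" and I = V])
      (use fin c measurable_argmax_on[OF fin ne, of "\<lambda>v x. x (v, True)"] in \<open>auto intro: countable_finite\<close>)
  then have F: "F \<in> borel_measurable (PiM (V \<times> UNIV) (\<lambda>_. borel))"
    unfolding F_def by measurable
  define s where "s \<omega> = argmax_on V (\<lambda>v. \<eta> v \<omega>)" for \<omega>
  have s: "s \<omega> \<in> V" for \<omega> using argmax_on[OF fin ne] by (simp add: s_def)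
  have F1: "F (\<lambda>i\<in>V \<times> UNIV. if snd i then a * \<eta> (fst i) (fst p) + b * \<eta> (fst i) (snd p)
         else b * \<eta> (fst i) (fst p) - a * \<eta> (fst i) (snd p)) = \<bar>orth_at_argmax a b p\<bar>" for p
  proof -
    have "argmax_on V (\<lambda>v. (\<lambda>i\<in>V \<times> UNIV. if snd i then a * \<eta> (fst i) (fst p) + b * \<eta> (fst i) (snd p)
         else b * \<eta> (fst i) (fst p) - a * \<eta> (fst i) (snd p)) (v, True)) = argmax_on V (rot a b p)"
      by (rule argmax_on_cong) (simp add: rot_def)
    then show ?thesis
      using argmax_on(1)[OF fin ne, of "rot a b p"] unfolding F_def by (simp add: orth_at_argmax_def rot_def)
  qed
  have F2: "F (\<lambda>i\<in>V \<times> UNIV. if snd i then \<eta> (fst i) (fst p) else \<eta> (fst i) (snd p)) = \<bar>\<eta> (s (fst p)) (snd p)\<bar>" for p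
  proof -
    have "argmax_on V (\<lambda>v. (\<lambda>i\<in>V \<times> UNIV. if snd i then \<eta> (fst i) (fst p) else \<eta> (fst i) (snd p)) (v, True)) = s (fst p)"
      unfolding s_def by (rule argmax_on_cong) simp
    then show ?thesis using s unfolding F_def by simp
  qed
  have sm: "s \<in> measurable M (count_space V)"
    unfolding s_def by (rule measurable_argmax_on[OF fin ne]) simp
  have i: "integrable PP (\<lambda>p. \<eta> (s (fst p)) (snd p))"
  proof (rule Bochner_Integration.integrable_bound)
    show "integrable PP (\<lambda>p. \<Sum>v\<in>V. \<bar>\<eta> v (snd p)\<bar>)"
      by (intro Bochner_Integration.integrable_sum integrable_abs integrable_PP_proj integrable_coord)
    have "\<bar>\<eta> (s (fst p)) (snd p)\<bar> \<le> (\<Sum>v\<in>V. \<bar>\<eta> v (snd p)\<bar>)" for p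
      using s fin by (intro member_le_sum[where f = "\<lambda>v. \<bar>\<eta> v (snd p)\<bar>"]) auto
    then show "AE p in PP. norm (\<eta> (s (fst p)) (snd p)) \<le> norm (\<Sum>v\<in>V. \<bar>\<eta> v (snd p)\<bar>)"
      by (intro AE_I2) (simp add: abs_of_nonneg sum_nonneg)
    show "(\<lambda>p. \<eta> (s (fst p)) (snd p)) \<in> borel_measurable PP"
      by (rule measurable_compose_countable'[where f = "\<lambda>v p. \<eta> v (snd p)" and I = V])
        (use fin measurable_compose[OF measurable_fst sm] in \<open>auto intro: countable_finite\<close>)
  qed
  have i': "integrable PP (\<lambda>p. \<bar>\<eta> (s (fst p)) (snd p)\<bar>)" using i by (rule integrable_abs)
  have "(\<integral>p. \<bar>orth_at_argmax a b p\<bar> \<partial>PP) = (\<integral>p. \<bar>\<eta> (s (fst p)) (snd p)\<bar> \<partial>PP)"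
    using rotation_integral[OF assms F] unfolding F1 F2 .
  \<comment> \<open>Given the first copy, the index \<open>s \<omega>\<close> is fixed, and the
    inner integral is the mean absolute value of a single coordinate.\<close>
  also have "\<dots> = (\<integral>\<omega>. (\<integral>\<omega>'. \<bar>\<eta> (s \<omega>) \<omega>'\<bar> \<partial>M) \<partial>M)"
    using P.integral_fst'[OF i'] by simp
  also have "\<dots> \<le> (\<integral>\<omega>. \<sigma> \<partial>M)"
    using P.integrable_fst'[OF i'] expectation_abs_coord[OF s]
    by (intro integral_mono) auto
  also have "\<dots> = \<sigma>" by (simp add: prob_space)
  finally show ?thesis .
qed

section \<open>Rotation in small steps and concentration in mean\<close>

lemma le_Max_rot: "v \<in> V \<Longrightarrow> rot a b p v \<le> Max (rot a b p ` V)"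
  using fin by (intro Max_ge) auto

text \<open>The matrix with rows (a, b) and (b, -a) is its own inverse.\<close>

lemma unrotate:
  assumes "a\<^sup>2 + b\<^sup>2 = 1"
  shows "\<eta> v (fst p) = a * rot a b p v + b * rot b (- a) p v"
    and "\<eta> v (snd p) = b * rot a b p v - a * rot b (- a) p v"
proof -
  have "a * rot a b p v + b * rot b (- a) p v = (a\<^sup>2 + b\<^sup>2) * \<eta> v (fst p)"
    "b * rot a b p v - a * rot b (- a) p v = (a\<^sup>2 + b\<^sup>2) * \<eta> v (snd p)"
    by (simp_all add: rot_def power2_eq_square algebra_simps)
  with assms show "\<eta> v (fst p) = a * rot a b p v + b * rot b (- a) p v"
    and "\<eta> v (snd p) = b * rot a b p v - a * rot b (- a) p v" by simp_all
qed

text \<open>Rotating the second copy into the first in small steps; each step moves the maximum, to first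
  order, by the orthogonal field at the current maximizer.\<close>

lemma Max_rot_step:
  "Max (rot (cos \<theta>) (sin \<theta>) p ` V) - Max (rot (cos (\<theta> - \<delta>)) (sin (\<theta> - \<delta>)) p ` V)
    \<le> (1 - cos \<delta>) * \<bar>Max (rot (cos \<theta>) (sin \<theta>) p ` V)\<bar> + \<bar>sin \<delta>\<bar> * \<bar>orth_at_argmax (cos \<theta>) (sin \<theta>) p\<bar>"
proof -
  let ?T = "Max (rot (cos \<theta>) (sin \<theta>) p ` V)"
  define v where "v = argmax_on V (rot (cos \<theta>) (sin \<theta>) p)"
  have v: "v \<in> V" "rot (cos \<theta>) (sin \<theta>) p v = ?T"
    using argmax_on[OF fin ne] by (auto simp: v_def)
  define z where "z = orth_at_argmax (cos \<theta>) (sin \<theta>) p"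
  \<comment> \<open>The old maximizer \<open>v\<close> is kept as a competitor at the new angle,
    which bounds the new maximum from below.\<close>
  have "rot (cos (\<theta> - \<delta>)) (sin (\<theta> - \<delta>)) p v
      = cos \<delta> * rot (cos \<theta>) (sin \<theta>) p v + sin \<delta> * rot (sin \<theta>) (- cos \<theta>) p v"
    by (simp add: rot_def cos_diff sin_diff algebra_simps)
  also have "\<dots> = cos \<delta> * ?T + sin \<delta> * z"
    using v(2) by (simp add: z_def orth_at_argmax_def flip: v_def)
  finally have "cos \<delta> * ?T + sin \<delta> * z \<le> Max (rot (cos (\<theta> - \<delta>)) (sin (\<theta> - \<delta>)) p ` V)"
    using le_Max_rot[OF v(1), of "cos (\<theta> - \<delta>)" "sin (\<theta> - \<delta>)" p] by simp
  moreover have "- (sin \<delta> * z) \<le> \<bar>sin \<delta>\<bar> * \<bar>z\<bar>"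
    unfolding abs_mult[symmetric] by linarith
  moreover have "(1 - cos \<delta>) * ?T \<le> (1 - cos \<delta>) * \<bar>?T\<bar>"
    by (intro mult_left_mono) auto
  ultimately show ?thesis unfolding z_def[symmetric] by (simp add: algebra_simps)
qed

text \<open>The one-sided bound \<open>Max_rot_step\<close> is used in both directions, from
  \<theta> by \<delta> and from \<theta> - \<delta> by -\<delta>. Adding the two error terms
  controls the absolute value and produces the factor 2.\<close>

lemma Max_rot_increment:
  defines "T \<equiv> \<lambda>\<theta> p. Max (rot (cos \<theta>) (sin \<theta>) p ` V)"
  defines "K \<equiv> expectation (\<lambda>\<omega>. \<bar>Max ((\<lambda>v. \<eta> v \<omega>) ` V)\<bar>)"
  shows "(\<integral>p. \<bar>T \<theta> p - T (\<theta> - \<delta>) p\<bar> \<partial>PP) \<le> 2 * ((1 - cos \<delta>) * K + \<bar>sin \<delta>\<bar> * \<sigma>)"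
proof -
  define B where "B \<theta> p = (1 - cos \<delta>) * \<bar>T \<theta> p\<bar> + \<bar>sin \<delta>\<bar> * \<bar>orth_at_argmax (cos \<theta>) (sin \<theta>) p\<bar>" for \<theta> p
  have iT: "integrable PP (T \<theta>)" for \<theta> unfolding T_def by (rule integrable_Max_rot)
  have iB: "integrable PP (B \<theta>)" for \<theta>
    unfolding B_def using iT integrable_orth_at_argmax by auto
  have B: "(\<integral>p. B \<theta> p \<partial>PP) \<le> (1 - cos \<delta>) * K + \<bar>sin \<delta>\<bar> * \<sigma>" for \<theta>
  proof -
    have "(\<integral>p. B \<theta> p \<partial>PP) = (1 - cos \<delta>) * (\<integral>p. \<bar>T \<theta> p\<bar> \<partial>PP) + \<bar>sin \<delta>\<bar> * (\<integral>p. \<bar>orth_at_argmax (cos \<theta>) (sin \<theta>) p\<bar> \<partial>PP)"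
      unfolding B_def using iT integrable_orth_at_argmax by simp
    also have "(\<integral>p. \<bar>T \<theta> p\<bar> \<partial>PP) = K"
      using integral_abs_Max_rot[of "cos \<theta>" "sin \<theta>" 0] by (simp add: T_def K_def)
    also have "(1 - cos \<delta>) * K + \<bar>sin \<delta>\<bar> * (\<integral>p. \<bar>orth_at_argmax (cos \<theta>) (sin \<theta>) p\<bar> \<partial>PP)
        \<le> (1 - cos \<delta>) * K + \<bar>sin \<delta>\<bar> * \<sigma>"
      by (intro add_left_mono mult_left_mono integral_abs_orth_at_argmax) auto
    finally show ?thesis .
  qed
  have nn: "0 \<le> B \<theta> p" for \<theta> p by (simp add: B_def)
  have "T \<theta> p - T (\<theta> - \<delta>) p \<le> B \<theta> p" "T (\<theta> - \<delta>) p - T \<theta> p \<le> B (\<theta> - \<delta>) p" for p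
    using Max_rot_step[of \<theta> p \<delta>] Max_rot_step[of "\<theta> - \<delta>" p "- \<delta>"]
    by (simp_all add: T_def B_def)
  then have "\<bar>T \<theta> p - T (\<theta> - \<delta>) p\<bar> \<le> B \<theta> p + B (\<theta> - \<delta>) p" for p
    using nn[of \<theta> p] nn[of "\<theta> - \<delta>" p] by (smt (verit))
  then have "(\<integral>p. \<bar>T \<theta> p - T (\<theta> - \<delta>) p\<bar> \<partial>PP) \<le> (\<integral>p. B \<theta> p + B (\<theta> - \<delta>) p \<partial>PP)"
    using iT iB by (intro integral_mono) auto
  also have "\<dots> \<le> 2 * ((1 - cos \<delta>) * K + \<bar>sin \<delta>\<bar> * \<sigma>)"
    using B[of \<theta>] B[of "\<theta> - \<delta>"] iB by simp
  finally show ?thesis .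
qed

text \<open>A quarter turn leads from the first copy (angle 0) to the second (angle pi/2). In N
  steps of size \<delta> = pi/(2N) each increment costs at most 2 \<delta> \<sigma> plus a term of
  order \<delta>^2; the sum tends to pi \<sigma>.\<close>

lemma integral_abs_Max_diff_le:
  "(\<integral>p. \<bar>Max ((\<lambda>v. \<eta> v (snd p)) ` V) - Max ((\<lambda>v. \<eta> v (fst p)) ` V)\<bar> \<partial>PP) \<le> pi * \<sigma>"
proof -
  define T where "T = (\<lambda>\<theta> p. Max (rot (cos \<theta>) (sin \<theta>) p ` V))"
  define K where "K = expectation (\<lambda>\<omega>. \<bar>Max ((\<lambda>v. \<eta> v \<omega>) ` V)\<bar>)"
  have K: "0 \<le> K" by (simp add: K_def)
  have iT: "integrable PP (T \<theta>)" for \<theta> unfolding T_def by (rule integrable_Max_rot)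
  have chain: "(\<integral>p. \<bar>T (real k * \<delta>) p - T 0 p\<bar> \<partial>PP) \<le> real k * (2 * ((1 - cos \<delta>) * K + \<bar>sin \<delta>\<bar> * \<sigma>))" for k \<delta>
  proof (induction k)
    case 0
    then show ?case by simp
  next
    case (Suc k)
    have "(\<integral>p. \<bar>T (real (Suc k) * \<delta>) p - T 0 p\<bar> \<partial>PP) \<le>
      (\<integral>p. \<bar>T (real (Suc k) * \<delta>) p - T (real (Suc k) * \<delta> - \<delta>) p\<bar> + \<bar>T (real k * \<delta>) p - T 0 p\<bar> \<partial>PP)"
    proof (rule integral_mono)
      have e: "real (Suc k) * \<delta> - \<delta> = real k * \<delta>" by (simp add: algebra_simps)
      show "\<bar>T (real (Suc k) * \<delta>) p - T 0 p\<bar> \<le> \<bar>T (real (Suc k) * \<delta>) p - T (real (Suc k) * \<delta> - \<delta>) p\<bar> + \<bar>T (real k * \<delta>) p - T 0 p\<bar>" for p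
        unfolding e by linarith
    qed (use iT in auto)
    also have "\<dots> = (\<integral>p. \<bar>T (real (Suc k) * \<delta>) p - T (real (Suc k) * \<delta> - \<delta>) p\<bar> \<partial>PP) + (\<integral>p. \<bar>T (real k * \<delta>) p - T 0 p\<bar> \<partial>PP)"
      using iT by (intro Bochner_Integration.integral_add) auto
    also have "\<dots> \<le> 2 * ((1 - cos \<delta>) * K + \<bar>sin \<delta>\<bar> * \<sigma>) + real k * (2 * ((1 - cos \<delta>) * K + \<bar>sin \<delta>\<bar> * \<sigma>))"
      using Suc.IH Max_rot_increment[of "real (Suc k) * \<delta>" \<delta>] unfolding T_def K_def by (intro add_mono)
    finally show ?case by (simp add: algebra_simps)
  qed
  let ?D = "\<integral>p. \<bar>T (pi/2) p - T 0 p\<bar> \<partial>PP"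
  have bound: "?D \<le> pi * \<sigma> + (pi\<^sup>2 * K / 4) * (1 / real (Suc n))" for n
  proof -
    define N where "N = real (Suc n)"
    define \<delta> where "\<delta> = pi / 2 / N"
    have N: "N > 0" by (simp add: N_def)
    have \<delta>: "\<delta> > 0" using N by (simp add: \<delta>_def)
    have "\<bar>sin (\<delta>/2)\<bar> \<le> \<bar>\<delta>/2\<bar>" by (rule abs_sin_x_le_abs_x)
    then have "(sin (\<delta>/2))\<^sup>2 \<le> (\<delta>/2)\<^sup>2" by (simp only: abs_le_square_iff)
    moreover have "cos \<delta> = 1 - 2 * (sin (\<delta>/2))\<^sup>2" using cos_double_sin[of "\<delta>/2"] by simp
    \<comment> \<open>The quadratic order matters: multiplied by N steps, the contribution of
      \<open>K\<close> still vanishes, so only its finiteness counts.\<close>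
    ultimately have c: "1 - cos \<delta> \<le> \<delta>\<^sup>2 / 2" by (simp add: power_divide)
    have s: "\<bar>sin \<delta>\<bar> \<le> \<delta>" using abs_sin_x_le_abs_x[of \<delta>] \<delta> by simp
    have "?D \<le> N * (2 * ((1 - cos \<delta>) * K + \<bar>sin \<delta>\<bar> * \<sigma>))"
      using chain[of "Suc n" \<delta>] N unfolding N_def[symmetric] by (simp add: \<delta>_def)
    also have "\<dots> \<le> N * (2 * ((\<delta>\<^sup>2 / 2) * K + \<delta> * \<sigma>))"
      using c s K \<sigma>_nonneg N by (intro mult_left_mono add_mono mult_right_mono) auto
    also have "\<dots> = pi * \<sigma> + (pi\<^sup>2 * K / 4) * (1 / N)"
      using N by (simp add: \<delta>_def field_simps power2_eq_square)
    finally show ?thesis by (simp add: N_def)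
  qed
  have "(\<lambda>n. pi * \<sigma> + (pi\<^sup>2 * K / 4) * (1 / real (Suc n))) \<longlonglongrightarrow> pi * \<sigma> + (pi\<^sup>2 * K / 4) * 0"
    by (intro tendsto_intros LIMSEQ_Suc[OF lim_1_over_n])
  then have "?D \<le> pi * \<sigma> + (pi\<^sup>2 * K / 4) * 0"
    by (rule LIMSEQ_le_const) (use bound in auto)
  then show ?thesis by (simp add: T_def rot_def[abs_def])
qed

text \<open>By Jensen the mean may be replaced by an independent copy of the supremum. The constant
  4 rounds up pi.\<close>

lemma concentration:
  "expectation (\<lambda>\<omega>. \<bar>Max ((\<lambda>v. \<eta> v \<omega>) ` V) - mean\<bar>) \<le> 4 * \<sigma>"
proof -
  let ?X = "\<lambda>\<omega>. Max ((\<lambda>v. \<eta> v \<omega>) ` V)"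
  have i: "integrable PP (\<lambda>p. \<bar>?X (snd p) - ?X (fst p)\<bar>)"
    using integrable_PP_proj[OF integrable_Max] by auto
  have "expectation (\<lambda>\<omega>. \<bar>?X \<omega> - mean\<bar>) \<le> expectation (\<lambda>\<omega>. expectation (\<lambda>\<omega>'. \<bar>?X \<omega>' - ?X \<omega>\<bar>))"
  proof (rule integral_mono)
    fix \<omega> assume "\<omega> \<in> space M"
    have "\<bar>?X \<omega> - mean\<bar> = \<bar>expectation (\<lambda>\<omega>'. ?X \<omega>' - ?X \<omega>)\<bar>"
      using integrable_Max by (simp add: mean_def prob_space abs_minus_commute)
    also have "\<dots> \<le> expectation (\<lambda>\<omega>'. \<bar>?X \<omega>' - ?X \<omega>\<bar>)" by (rule integral_abs_bound)
    finally show "\<bar>?X \<omega> - mean\<bar> \<le> expectation (\<lambda>\<omega>'. \<bar>?X \<omega>' - ?X \<omega>\<bar>)" .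
  qed (use integrable_Max P.integrable_fst'[OF i] in auto)
  also have "\<dots> = (\<integral>p. \<bar>?X (snd p) - ?X (fst p)\<bar> \<partial>PP)" using P.integral_fst'[OF i] by simp
  also have "\<dots> \<le> pi * \<sigma>" by (rule integral_abs_Max_diff_le)
  also have "\<dots> \<le> 4 * \<sigma>" using pi_less_4 \<sigma>_nonneg by (intro mult_right_mono) auto
  finally show ?thesis .
qed

text \<open>Linear combinations over \<open>S\<close> are padded with zero coefficients. This makes
  concentration available for the supremum over a level set, at the scale \<sigma> of the whole
  field.\<close>

lemma gaussian_subvector:
  assumes "S \<subseteq> V" "S \<noteq> {}"
  shows "gaussian_vector M S \<eta> \<sigma>"
proof
  show "finite S" using assms fin finite_subset by blast
  show "centered_gaussian_field M S \<eta>"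
    unfolding centered_gaussian_field_def
  proof (intro conjI allI)
    fix c :: "'b \<Rightarrow> real"
    have "(\<Sum>v\<in>V. (if v \<in> S then c v else 0) * \<eta> v \<omega>) = (\<Sum>v\<in>S. c v * \<eta> v \<omega>)" for \<omega>
      using assms fin by (intro sum.mono_neutral_cong_right) auto
    then show "centered_normal_rv M (\<lambda>\<omega>. \<Sum>v\<in>S. c v * \<eta> v \<omega>)"
      using centered_normal_lincomb[of "\<lambda>v. if v \<in> S then c v else 0"] by simp
  qed (rule prob_space_axioms)
qed (use assms sd \<sigma>_nonneg in auto)

end

section \<open>Level sets\<close>

context gaussian_vector
begin

text \<open>The real-valued form of \<open>exp_sup\<close>; it is meaningful only for nonempty
  \<open>S\<close>, and the empty level set is always split off as a separate case.\<close>

definition mean_on :: "'b set \<Rightarrow> real" where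
  "mean_on S = expectation (\<lambda>\<omega>. Max ((\<lambda>v. \<eta> v \<omega>) ` S))"

lemma integrable_Max_on:
  assumes "S \<subseteq> V" "S \<noteq> {}"
  shows "integrable M (\<lambda>\<omega>. Max ((\<lambda>v. \<eta> v \<omega>) ` S))"
  using gaussian_vector.integrable_Max[OF gaussian_subvector[OF assms]] .

lemma concentration_on:
  assumes "S \<subseteq> V" "S \<noteq> {}"
  shows "expectation (\<lambda>\<omega>. \<bar>Max ((\<lambda>v. \<eta> v \<omega>) ` S) - mean_on S\<bar>) \<le> 4 * \<sigma>"
  using gaussian_vector.concentration[OF gaussian_subvector[OF assms]]
    gaussian_vector.mean_def[OF gaussian_subvector[OF assms]]
  by (simp add: mean_on_def)

text \<open>With \<omega> fixed, \<open>U\<close> is a deterministic set, so averaging over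
  \<omega>' yields \<open>mean_on U\<close>. The left side equals \<alpha>^2 \<open>mean\<close> + c
  \<open>mean_on U\<close> - \<open>mean\<close> because \<alpha>^2 + c^2 = 1.\<close>

lemma mean_on_level_set_upper:
  assumes "0 < \<alpha>" "\<alpha> < 1" and c: "c = sqrt (1 - \<alpha>\<^sup>2)"
    and U: "U = level_set \<eta> V \<alpha> mean \<omega>" "U \<noteq> {}"
  shows "c * (mean_on U - c * mean) \<le> expectation (\<lambda>\<omega>'. \<bar>Max (rot \<alpha> c (\<omega>, \<omega>') ` V) - mean\<bar>)"
proof -
  have UV: "U \<subseteq> V" and finU: "finite U"
    using U fin by (auto simp: level_set_def)
  have "\<alpha>\<^sup>2 \<le> 1" using assms by (simp add: power_le_one)
  then have c2: "c\<^sup>2 = 1 - \<alpha>\<^sup>2" "0 \<le> c" by (simp_all add: c)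
  let ?T = "\<lambda>\<omega>'. Max (rot \<alpha> c (\<omega>, \<omega>') ` V)" and ?X = "\<lambda>\<omega>'. Max ((\<lambda>v. \<eta> v \<omega>') ` U)"
  have pw: "\<alpha>\<^sup>2 * mean + c * ?X \<omega>' \<le> ?T \<omega>'" for \<omega>'
  proof -
    have "?X \<omega>' \<in> (\<lambda>v. \<eta> v \<omega>') ` U" using finU U(2) by (intro Max_in) auto
    then obtain v where v: "v \<in> U" "?X \<omega>' = \<eta> v \<omega>'" by auto
    then have "\<alpha> * mean \<le> \<eta> v \<omega>" using U(1) by (simp add: level_set_def)
    then have "\<alpha> * (\<alpha> * mean) \<le> \<alpha> * \<eta> v \<omega>" using assms by simp
    then have "\<alpha>\<^sup>2 * mean + c * ?X \<omega>' \<le> rot \<alpha> c (\<omega>, \<omega>') v"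
      by (simp add: rot_def v(2) power2_eq_square mult.assoc)
    also have "\<dots> \<le> ?T \<omega>'" using v(1) UV by (intro le_Max_rot) auto
    finally show ?thesis .
  qed
  have iX: "integrable M ?X" by (rule integrable_Max_on[OF UV U(2)])
  have iT: "integrable M ?T" by (rule integrable_section_Max_rot)
  have "\<alpha>\<^sup>2 * mean + c * mean_on U - mean = expectation (\<lambda>\<omega>'. (\<alpha>\<^sup>2 * mean + c * ?X \<omega>') - mean)"
    using iX by (simp add: mean_on_def prob_space)
  also have "\<dots> \<le> expectation (\<lambda>\<omega>'. \<bar>?T \<omega>' - mean\<bar>)"
  proof (rule integral_mono)
    show "\<alpha>\<^sup>2 * mean + c * ?X \<omega>' - mean \<le> \<bar>?T \<omega>' - mean\<bar>" for \<omega>' using pw[of \<omega>'] by linarith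
  qed (use iX iT in auto)
  finally have "\<alpha>\<^sup>2 * mean + c * mean_on U - mean \<le> expectation (\<lambda>\<omega>'. \<bar>?T \<omega>' - mean\<bar>)" .
  moreover have "c * (mean_on U - c * mean) = \<alpha>\<^sup>2 * mean + c * mean_on U - mean"
  proof -
    have "c * (mean_on U - c * mean) = c * mean_on U - c\<^sup>2 * mean" by (simp add: power2_eq_square algebra_simps)
    then show ?thesis by (simp add: c2 algebra_simps)
  qed
  ultimately show ?thesis by simp
qed

text \<open>A quantitative contrapositive: if \<open>U\<close> is empty or has too small a mean, the
  rotated pair must be atypical. For each \<omega>' with error \<open>R\<close> below \<kappa>
  \<open>mean\<close>, the maximizer lies in \<open>U\<close> and lifts the supremum over
  \<open>U\<close> by \<kappa> \<open>mean\<close> above its mean. Concentration on \<open>U\<close>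
  charges such excesses at most 4 \<sigma> on average.\<close>

lemma mean_on_level_set_lower:
  assumes \<omega>: "\<omega> \<in> space M" and ab: "a\<^sup>2 + b\<^sup>2 = 1" "0 \<le> a" "0 \<le> b"
    and \<kappa>: "\<kappa> \<le> a - \<alpha>" and m: "0 < mean"
    and U: "U = level_set \<eta> V \<alpha> mean \<omega>"
    and small: "U = {} \<or> mean_on U \<le> (b - 2 * \<kappa>) * mean"
  shows "\<kappa> * mean - 4 * \<sigma> \<le>
    expectation (\<lambda>\<omega>'. \<bar>Max (rot a b (\<omega>, \<omega>') ` V) - mean\<bar> + \<bar>orth_at_argmax a b (\<omega>, \<omega>')\<bar>)"
proof -
  have UV: "U \<subseteq> V" and finU: "finite U"
    using U fin by (auto simp: level_set_def)
  define R where "R \<omega>' = \<bar>Max (rot a b (\<omega>, \<omega>') ` V) - mean\<bar> + \<bar>orth_at_argmax a b (\<omega>, \<omega>')\<bar>" for \<omega>'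
  \<comment> \<open>The value 0 for empty \<open>U\<close> keeps the bound on the expectation of
    \<open>W\<close>; wherever \<open>W\<close> has to be large below, \<open>U\<close> contains the
    maximizer.\<close>
  define W where "W \<omega>' = (if U = {} then 0 else \<bar>Max ((\<lambda>v. \<eta> v \<omega>') ` U) - mean_on U\<bar>)" for \<omega>'
  have iR: "integrable M R" unfolding R_def
    using integrable_section_Max_rot integrable_section_orth_at_argmax[OF \<omega>] by auto
  have iW: "integrable M W" unfolding W_def using integrable_Max_on[OF UV] by (cases "U = {}") simp_all
  have EW: "expectation W \<le> 4 * \<sigma>"
    unfolding W_def using concentration_on[OF UV] \<sigma>_nonneg by (cases "U = {}") simp_all
  have "b\<^sup>2 \<le> 1" "a\<^sup>2 \<le> 1"
    using ab(1) zero_le_power2[of a] zero_le_power2[of b] by linarith+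
  then have ab1: "a \<le> 1" "b \<le> 1" by (simp_all add: power2_le_imp_le)
  have pw: "\<kappa> * mean \<le> R \<omega>' + W \<omega>'" for \<omega>'
  proof (cases "\<kappa> * mean \<le> R \<omega>'")
    case True
    then show ?thesis by (auto simp: W_def)
  next
    case False
    define v where "v = argmax_on V (rot a b (\<omega>, \<omega>'))"
    define T where "T = Max (rot a b (\<omega>, \<omega>') ` V)"
    define z where "z = orth_at_argmax a b (\<omega>, \<omega>')"
    have v: "v \<in> V" "rot a b (\<omega>, \<omega>') v = T"
      using argmax_on[OF fin ne] by (auto simp: v_def T_def)
    have z: "rot b (- a) (\<omega>, \<omega>') v = z" by (simp add: z_def orth_at_argmax_def v_def)
    have R: "R \<omega>' = \<bar>T - mean\<bar> + \<bar>z\<bar>" by (simp add: R_def T_def z_def)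
    have le: "\<bar>x * y\<bar> \<le> \<bar>y\<bar>" if "0 \<le> x" "x \<le> 1" for x y :: real
      using that by (simp add: abs_mult mult_left_le_one_le)
    \<comment> \<open>Since a and b are at most 1, the single error \<open>R\<close> dominates the
      deviations of both unrotated fields at \<open>v\<close>.\<close>
    have bounds: "\<bar>a * (T - mean)\<bar> \<le> \<bar>T - mean\<bar>" "\<bar>b * (T - mean)\<bar> \<le> \<bar>T - mean\<bar>"
      "\<bar>a * z\<bar> \<le> \<bar>z\<bar>" "\<bar>b * z\<bar> \<le> \<bar>z\<bar>"
      using le ab ab1 by auto
    have "\<eta> v \<omega> = a * mean + a * (T - mean) + b * z"
      using unrotate(1)[OF ab(1), of v "(\<omega>, \<omega>')"] by (simp add: v z algebra_simps)
    then have 1: "\<eta> v \<omega> \<ge> a * mean - R \<omega>'" using bounds unfolding R by linarith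
    have "\<eta> v \<omega>' = b * mean + b * (T - mean) - a * z"
      using unrotate(2)[OF ab(1), of v "(\<omega>, \<omega>')"] by (simp add: v z algebra_simps)
    then have 2: "\<eta> v \<omega>' \<ge> b * mean - R \<omega>'" using bounds unfolding R by linarith
    \<comment> \<open>The margin between \<open>a\<close> and \<alpha> absorbs the error, which puts
      \<open>v\<close> into the level set.\<close>
    have "\<kappa> * mean \<le> (a - \<alpha>) * mean" using \<kappa> m by (intro mult_right_mono) auto
    then have "\<alpha> * mean \<le> \<eta> v \<omega>" using 1 False by (simp add: algebra_simps)
    then have vU: "v \<in> U" using v(1) U by (simp add: level_set_def)
    then have "\<eta> v \<omega>' \<le> Max ((\<lambda>v. \<eta> v \<omega>') ` U)" using finU by (intro Max_ge) auto
    moreover have "mean_on U \<le> (b - 2 * \<kappa>) * mean" using small vU by auto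
    ultimately have "\<kappa> * mean \<le> Max ((\<lambda>v. \<eta> v \<omega>') ` U) - mean_on U"
      using 2 False by (simp add: algebra_simps)
    also have "\<dots> \<le> W \<omega>'" using vU by (auto simp: W_def)
    also have "\<dots> \<le> R \<omega>' + W \<omega>'" by (simp add: R_def)
    finally show ?thesis .
  qed
  have "\<kappa> * mean = expectation (\<lambda>_. \<kappa> * mean)" by (simp add: prob_space)
  also have "\<dots> \<le> expectation (\<lambda>\<omega>'. R \<omega>' + W \<omega>')"
    using pw iR iW by (intro integral_mono) auto
  also have "\<dots> = expectation R + expectation W" using iR iW by simp
  finally show ?thesis using EW unfolding R_def by linarith
qed

text \<open>The deviation event is covered by two events on which a conditional mean error is large,
  and Markov's inequality bounds each. The constants come from 4 \<sigma> against the threshold c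
  \<epsilon> \<open>mean\<close> for the upper side and 5 \<sigma> against \<kappa>
  \<open>mean\<close> / 2 for the lower side.\<close>

lemma measure_level_set_deviation:
  assumes \<alpha>: "0 < \<alpha>" "\<alpha> < 1" and c: "c = sqrt (1 - \<alpha>\<^sup>2)" and \<epsilon>: "0 < \<epsilon>"
    and a: "\<alpha> < a" "a < 1" "c - \<epsilon> / 2 \<le> sqrt (1 - a\<^sup>2)"
    and \<kappa>: "0 < \<kappa>" "\<kappa> \<le> a - \<alpha>" "\<kappa> \<le> \<epsilon> / 4"
    and m: "0 < mean" and large: "8 * \<sigma> \<le> \<kappa> * mean"
  shows "measure M {\<omega> \<in> space M. level_set \<eta> V \<alpha> mean \<omega> = {} \<or>
      \<epsilon> < \<bar>mean_on (level_set \<eta> V \<alpha> mean \<omega>) / mean - c\<bar>}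
    \<le> (4 / (c * \<epsilon>) + 10 / \<kappa>) * (\<sigma> / mean)"
proof -
  define b where "b = sqrt (1 - a\<^sup>2)"
  have "a\<^sup>2 \<le> 1" "\<alpha>\<^sup>2 < 1" using \<alpha> a by (auto simp: power_le_one abs_square_less_1)
  then have ab: "a\<^sup>2 + b\<^sup>2 = 1" "0 \<le> b" and \<alpha>c: "\<alpha>\<^sup>2 + c\<^sup>2 = 1" and c0: "0 < c"
    by (simp_all add: b_def c)
  define D where "D p = \<bar>Max (rot \<alpha> c p ` V) - mean\<bar>" for p
  define R where "R p = \<bar>Max (rot a b p ` V) - mean\<bar> + \<bar>orth_at_argmax a b p\<bar>" for p
  have iD: "integrable PP D" unfolding D_def using integrable_Max_rot by auto
  have iR: "integrable PP R" unfolding R_def using integrable_Max_rot integrable_orth_at_argmax by auto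
  have ED: "(\<integral>p. D p \<partial>PP) \<le> 4 * \<sigma>"
    unfolding D_def integral_abs_Max_rot[OF \<alpha>c] by (rule concentration)
  have "(\<integral>p. R p \<partial>PP) = (\<integral>p. \<bar>Max (rot a b p ` V) - mean\<bar> \<partial>PP) + (\<integral>p. \<bar>orth_at_argmax a b p\<bar> \<partial>PP)"
    unfolding R_def using integrable_Max_rot integrable_orth_at_argmax by simp
  \<comment> \<open>Concentration gives 4 \<sigma>, the orthogonal field at the maximizer one
    more.\<close>
  then have ER: "(\<integral>p. R p \<partial>PP) \<le> 5 * \<sigma>"
    unfolding integral_abs_Max_rot[OF ab(1)]
    using concentration integral_abs_orth_at_argmax[OF ab(1)] by linarith
  \<comment> \<open>The level set depends on the first copy only, so the errors are averaged over
    the second copy; Fubini keeps their expectations.\<close>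
  define D' where "D' \<omega> = expectation (\<lambda>\<omega>'. D (\<omega>, \<omega>'))" for \<omega>
  define R' where "R' \<omega> = expectation (\<lambda>\<omega>'. R (\<omega>, \<omega>'))" for \<omega>
  have iD': "integrable M D'" and iR': "integrable M R'"
    unfolding D'_def R'_def using iD iR by (auto intro: P.integrable_fst')
  have ED': "expectation D' \<le> 4 * \<sigma>" and ER': "expectation R' \<le> 5 * \<sigma>"
    unfolding D'_def R'_def using ED ER P.integral_fst'[OF iD] P.integral_fst'[OF iR] by simp_all
  have D0: "0 \<le> D' \<omega>" and R0: "0 \<le> R' \<omega>" for \<omega>
    by (auto simp: D'_def R'_def D_def R_def)
  have [measurable]: "D' \<in> borel_measurable M" "R' \<in> borel_measurable M" using iD' iR' by auto
  let ?A = "{\<omega> \<in> space M. c * \<epsilon> * mean \<le> D' \<omega>}" and ?B = "{\<omega> \<in> space M. \<kappa> * mean / 2 \<le> R' \<omega>}"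
  have sub: "{\<omega> \<in> space M. level_set \<eta> V \<alpha> mean \<omega> = {} \<or>
      \<epsilon> < \<bar>mean_on (level_set \<eta> V \<alpha> mean \<omega>) / mean - c\<bar>} \<subseteq> ?A \<union> ?B"
  proof
    fix \<omega> assume "\<omega> \<in> {\<omega> \<in> space M. level_set \<eta> V \<alpha> mean \<omega> = {} \<or>
      \<epsilon> < \<bar>mean_on (level_set \<eta> V \<alpha> mean \<omega>) / mean - c\<bar>}"
    then have \<omega>: "\<omega> \<in> space M" and bad: "level_set \<eta> V \<alpha> mean \<omega> = {} \<or>
      \<epsilon> < \<bar>mean_on (level_set \<eta> V \<alpha> mean \<omega>) / mean - c\<bar>" by auto
    define U where "U = level_set \<eta> V \<alpha> mean \<omega>"
    show "\<omega> \<in> ?A \<union> ?B"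
    proof (cases "U \<noteq> {} \<and> \<epsilon> < mean_on U / mean - c")
      case True
      then have "\<epsilon> * mean < mean_on U - c * mean" using m by (simp add: field_simps)
      then have "c * (\<epsilon> * mean) \<le> c * (mean_on U - c * mean)" using c0 by (intro mult_left_mono) auto
      also have "\<dots> \<le> D' \<omega>"
        unfolding D'_def D_def using mean_on_level_set_upper[OF \<alpha> c U_def] True by simp
      finally show ?thesis using \<omega> by (simp add: mult.assoc)
    next
      case False
      have "mean_on U \<le> (b - 2 * \<kappa>) * mean" if "U \<noteq> {}"
      proof -
        have "mean_on U / mean \<le> c - \<epsilon>" using that False bad unfolding U_def[symmetric] by auto
        \<comment> \<open>Half of \<epsilon> pays for replacing \<open>c\<close> by
          \<open>b\<close>, the other half for 2 \<kappa>.\<close>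
        also have "\<dots> \<le> b - 2 * \<kappa>" using a(3) \<kappa>(3) unfolding b_def by linarith
        finally show ?thesis using m by (simp add: field_simps)
      qed
      then have "\<kappa> * mean - 4 * \<sigma> \<le> R' \<omega>"
        unfolding R'_def R_def
        using mean_on_level_set_lower[OF \<omega> ab(1) _ ab(2) \<kappa>(2) m U_def] \<alpha> a by auto
      \<comment> \<open>By \<open>large\<close>, 4 \<sigma> is at most half of \<kappa>
        \<open>mean\<close>, which leaves the threshold in \<open>?B\<close>.\<close>
      then show ?thesis using \<omega> large by auto
    qed
  qed
  have "measure M {\<omega> \<in> space M. level_set \<eta> V \<alpha> mean \<omega> = {} \<or>
      \<epsilon> < \<bar>mean_on (level_set \<eta> V \<alpha> mean \<omega>) / mean - c\<bar>} \<le> measure M (?A \<union> ?B)"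
    by (rule finite_measure_mono[OF sub]) measurable
  also have "\<dots> \<le> measure M ?A + measure M ?B"
    by (rule measure_Un_le) measurable
  also have "\<dots> \<le> expectation D' / (c * \<epsilon> * mean) + expectation R' / (\<kappa> * mean / 2)"
    using iD' iR' D0 R0 c0 \<epsilon> m \<kappa>
    by (intro add_mono integral_Markov_inequality_measure[where A = "{}"]) auto
  also have "\<dots> \<le> 4 * \<sigma> / (c * \<epsilon> * mean) + 5 * \<sigma> / (\<kappa> * mean / 2)"
    using ED' ER' c0 \<epsilon> m \<kappa> by (intro add_mono divide_right_mono) auto
  also have "\<dots> = (4 / (c * \<epsilon>) + 10 / \<kappa>) * (\<sigma> / mean)"
    using c0 \<epsilon> m \<kappa> by (simp add: field_simps)
  finally show ?thesis .
qed

end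

section \<open>Passage to the sequence of fields\<close>

lemma gaussian_vector_max_sd:
  assumes "finite V" "V \<noteq> {}" "centered_gaussian_field M V \<eta>"
  shows "gaussian_vector M V \<eta> (max_sd M \<eta> V)"
proof
  let ?Q = "(\<lambda>v. \<integral>\<omega>. (\<eta> v \<omega>)\<^sup>2 \<partial>M) ` V"
  have le: "q \<le> Max ?Q" if "q \<in> ?Q" for q using that assms by (intro Max_ge) auto
  obtain v where "v \<in> V" using assms by auto
  then have "0 \<le> Max ?Q" using le[of "\<integral>\<omega>. (\<eta> v \<omega>)\<^sup>2 \<partial>M"]
    by (intro order_trans[OF integral_nonneg_AE]) auto
  then show "(\<integral>\<omega>. (\<eta> v \<omega>)\<^sup>2 \<partial>M) \<le> (max_sd M \<eta> V)\<^sup>2" if "v \<in> V" for v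
    using le that by (simp add: max_sd_def)
  show "0 \<le> max_sd M \<eta> V" using \<open>0 \<le> Max ?Q\<close> by (simp add: max_sd_def)
qed (use assms in auto)

theorem theorem1p1:
  fixes M :: "nat \<Rightarrow> 'a measure"
    and V :: "nat \<Rightarrow> 'b set"
    and \<eta> :: "nat \<Rightarrow> 'b \<Rightarrow> 'a \<Rightarrow> real"
    and \<alpha> :: real
  assumes fin: "\<And>n. finite (V n)"
    and ne: "\<And>n. V n \<noteq> {}"
    and gauss: "\<And>n. centered_gaussian_field (M n) (V n) (\<eta> n)"
    and nondeg: "filterlim
        (\<lambda>n. real_of_ereal (exp_sup (M n) (\<eta> n) (V n)) / max_sd (M n) (\<eta> n) (V n))
        at_top sequentially"
    and \<alpha>: "0 < \<alpha>" "\<alpha> < 1"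
  shows "\<forall>\<epsilon>>0. (\<lambda>n. measure (M n)
           {\<omega> \<in> space (M n).
              let gV = exp_sup (M n) (\<eta> n) (V n);
                  U = level_set (\<eta> n) (V n) \<alpha> (real_of_ereal gV) \<omega>
              in \<not> \<bar>exp_sup (M n) (\<eta> n) U / gV - ereal (sqrt (1 - \<alpha>\<^sup>2))\<bar> \<le> ereal \<epsilon>})
         \<longlonglongrightarrow> 0"
proof (intro allI impI)
  fix \<epsilon> :: real assume \<epsilon>: "0 < \<epsilon>"
  define c where "c = sqrt (1 - \<alpha>\<^sup>2)"
  \<comment> \<open>By continuity, some \<open>a\<close> strictly above \<alpha> lowers the square
    root by at most \<epsilon>/2; it is chosen once for all n.\<close>
  have "((\<lambda>a. sqrt (1 - a\<^sup>2)) \<longlongrightarrow> c) (at_right \<alpha>)"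
    unfolding c_def by (intro tendsto_intros)
  then have "eventually (\<lambda>a. c - \<epsilon> / 2 < sqrt (1 - a\<^sup>2)) (at_right \<alpha>)"
    using \<epsilon> by (intro order_tendstoD) auto
  moreover have "eventually (\<lambda>a. \<alpha> < a \<and> a < 1) (at_right \<alpha>)"
    using eventually_at_right_real[OF \<alpha>(2)] by simp
  ultimately have "eventually (\<lambda>a. c - \<epsilon> / 2 < sqrt (1 - a\<^sup>2) \<and> \<alpha> < a \<and> a < 1) (at_right \<alpha>)"
    by eventually_elim auto
  from eventually_happens'[OF trivial_limit_at_right_real this]
  obtain a where a: "c - \<epsilon> / 2 \<le> sqrt (1 - a\<^sup>2)" "\<alpha> < a" "a < 1"
    by (meson less_imp_le)
  define \<kappa> where "\<kappa> = min (a - \<alpha>) (\<epsilon> / 4)"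
  have \<kappa>: "0 < \<kappa>" "\<kappa> \<le> a - \<alpha>" "\<kappa> \<le> \<epsilon> / 4" using a \<epsilon> unfolding \<kappa>_def by linarith+
  define s where "s n = max_sd (M n) (\<eta> n) (V n)" for n
  define m where "m n = gaussian_vector.mean (M n) (V n) (\<eta> n)" for n
  have G: "gaussian_vector (M n) (V n) (\<eta> n) (s n)" for n
    unfolding s_def by (rule gaussian_vector_max_sd[OF fin ne gauss])
  have gV: "exp_sup (M n) (\<eta> n) (V n) = ereal (m n)" for n
    using ne[of n] by (simp add: exp_sup_def m_def gaussian_vector.mean_def[OF G])
  have r: "filterlim (\<lambda>n. m n / s n) at_top sequentially"
    using nondeg by (simp add: gV s_def)
  let ?C = "4 / (c * \<epsilon>) + 10 / \<kappa>"
  let ?p = "\<lambda>n. measure (M n)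
           {\<omega> \<in> space (M n).
              let gV = exp_sup (M n) (\<eta> n) (V n);
                  U = level_set (\<eta> n) (V n) \<alpha> (real_of_ereal gV) \<omega>
              in \<not> \<bar>exp_sup (M n) (\<eta> n) U / gV - ereal (sqrt (1 - \<alpha>\<^sup>2))\<bar> \<le> ereal \<epsilon>}"
  \<comment> \<open>The threshold 8/\<kappa> is what \<open>measure_level_set_deviation\<close>
    requires of the ratio of mean to standard deviation.\<close>
  have "eventually (\<lambda>n. 8 / \<kappa> < m n / s n) sequentially"
    using r by (simp add: filterlim_at_top_dense)
  then have ev: "eventually (\<lambda>n. ?p n \<le> ?C * inverse (m n / s n)) sequentially"
  proof eventually_elim
    case (elim n)
    interpret gaussian_vector "M n" "V n" "\<eta> n" "s n" by (rule G)
    have pos: "0 < m n / s n" using elim \<kappa> less_trans[of 0 "8 / \<kappa>"] by simp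
    \<comment> \<open>Division by 0 yields 0, so a positive ratio with a nonnegative denominator
      forces both to be positive.\<close>
    then have s: "0 < s n" and m: "0 < m n"
      using \<sigma>_nonneg by (auto simp: zero_less_divide_iff)
    have "8 / \<kappa> * s n < m n" using elim s by (simp add: pos_less_divide_eq)
    then have large: "8 * s n \<le> \<kappa> * m n" using \<kappa>(1) by (simp add: pos_divide_less_eq mult.commute)
    have mean: "mean = m n" by (simp add: m_def)
    have e: "{\<omega> \<in> space (M n).
              let gV = exp_sup (M n) (\<eta> n) (V n);
                  U = level_set (\<eta> n) (V n) \<alpha> (real_of_ereal gV) \<omega>
              in \<not> \<bar>exp_sup (M n) (\<eta> n) U / gV - ereal (sqrt (1 - \<alpha>\<^sup>2))\<bar> \<le> ereal \<epsilon>}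
       = {\<omega> \<in> space (M n). level_set (\<eta> n) (V n) \<alpha> mean \<omega> = {} \<or>
      \<epsilon> < \<bar>mean_on (level_set (\<eta> n) (V n) \<alpha> mean \<omega>) / mean - c\<bar>}"
    proof (rule Collect_cong, rule conj_cong[OF refl])
      fix \<omega>
      define U where "U = level_set (\<eta> n) (V n) \<alpha> (m n) \<omega>"
      \<comment> \<open>For empty \<open>U\<close> the ratio is minus infinity, its distance to
        \<open>c\<close> is infinite, and the event counts as a deviation.\<close>
      have "(\<not> \<bar>exp_sup (M n) (\<eta> n) U / ereal (m n) - ereal c\<bar> \<le> ereal \<epsilon>) \<longleftrightarrow>
          U = {} \<or> \<epsilon> < \<bar>mean_on U / m n - c\<bar>"
      proof (cases "U = {}")
        case True
        then show ?thesis using m by (simp add: exp_sup_def)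
      next
        case False
        then have "exp_sup (M n) (\<eta> n) U = ereal (mean_on U)" by (simp add: exp_sup_def mean_on_def)
        with False m show ?thesis by (simp add: not_le)
      qed
      then show "(let gV = exp_sup (M n) (\<eta> n) (V n);
                  U = level_set (\<eta> n) (V n) \<alpha> (real_of_ereal gV) \<omega>
              in \<not> \<bar>exp_sup (M n) (\<eta> n) U / gV - ereal (sqrt (1 - \<alpha>\<^sup>2))\<bar> \<le> ereal \<epsilon>) \<longleftrightarrow>
          level_set (\<eta> n) (V n) \<alpha> mean \<omega> = {} \<or>
          \<epsilon> < \<bar>mean_on (level_set (\<eta> n) (V n) \<alpha> mean \<omega>) / mean - c\<bar>"
        by (simp only: Let_def gV mean U_def c_def real_of_ereal.simps)
    qed
    show ?case
      unfolding e
      using measure_level_set_deviation[OF \<alpha> c_def \<epsilon> a(2,3,1) \<kappa>, unfolded mean, OF m large]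
      by (simp add: mean)
  qed
  \<comment> \<open>\<open>?C\<close> depends on \<alpha>, \<epsilon> and the chosen
    \<open>a\<close> but not on n, so non-degeneracy alone drives the bound to 0.\<close>
  have "((\<lambda>n. ?C * inverse (m n / s n)) \<longlongrightarrow> ?C * 0) sequentially"
    by (intro tendsto_intros tendsto_inverse_0_at_top r)
  then have lim: "(\<lambda>n. ?C * inverse (m n / s n)) \<longlonglongrightarrow> 0" by simp
  show "?p \<longlonglongrightarrow> 0"
    by (rule real_tendsto_sandwich[OF _ ev tendsto_const lim]) simp
qed

end
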